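(* For every $\eta\in L^1(\Gamma_I)$ with $\eta\ge0$ a.e. on $\Gamma_I$, there holds $\Pi_h^{\mathrm m}\eta\ge0$ a.e. on $\Gamma_I$ and $\|\Pi_h^{\mathrm m}\eta\|_{1,\Gamma_I}=\|\eta\|_{1,\Gamma_I}$. In particular, $\Pi_h^{\mathrm m}(\mathcal H_m)\subseteq\mathcal H_m^h$.
   Context: Let $d\in\{2,3\}$, let $\Omega\subseteq\mathbb R^d$ be a bounded polyhedral Lipschitz domain, and let $\Gamma_I\subseteq\partial\Omega$ be non-empty and relatively open. $\mathcal T_h$ is a member of a shape-regular family of (conforming, simplicial) triangulations of $\Omega$ such that $\overline\Gamma_I$ is the union of the set $\mathcal S_h^I$ of boundary facets contained in it. $\mathcal S^1(\mathcal S_h^I)$ is the space of continuous, facet-wise affine functions on $\overline\Gamma_I$; $I_h:C^0(\overline\Gamma_I)\to\mathcal S^1(\mathcal S_h^I)$ is nodal interpolation (at the mesh nodes in $\overline\Gamma_I$); $(v,w)_{\Gamma_I}:=\int_{\Gamma_I}vw\,\mathrm ds$, $(v,w)_{\Gamma_I,h}:=(I_h\{vw\},1)_{\Gamma_I}$, and $\|\cdot\|_{1,\Gamma_I}$ is the $L^1(\Gamma_I)$ norm. The mass-lumped $L^2$-projection $\Pi_h^{\mathrm m}:L^1(\Gamma_I)\to\mathcal S^1(\mathcal S_h^I)$ is defined, for $\eta\in L^1(\Gamma_I)$, by $$(\Pi_h^{\mathrm m}\eta,\mu_h)_{\Gamma_I,h}=(\eta,\mu_h)_{\Gamma_I}\quad\text{for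 all }\mu_h\in\mathcal S^1(\mathcal S_h^I).$$ For a fixed $m>0$, $$\mathcal H_m:=\{\eta\in L^2(\Gamma_I)\mid\eta\ge0\text{ a.e. on }\Gamma_I,\ (\eta,1)_{\Gamma_I}=m\},\qquad\mathcal H_m^h:=\{\eta_h\in\mathcal S^1(\mathcal S_h^I)\mid\eta_h\ge0\text{ on }\Gamma_I,\ (\eta_h,1)_{\Gamma_I,h}=m\}.$$ *)

theory Defs
  imports "HOL-Analysis.Analysis"
begin

text \<open>The normalisation \<open>unit_ball_vol s / 2 ^ s\<close> makes the \<open>s\<close>-dimensional Hausdorff measure of a
  subset of an \<open>s\<close>-dimensional affine subspace equal to its \<open>s\<close>-dimensional Lebesgue measure. The
  empty set is treated separately because \<open>0 ^ 0 = 1\<close>; boundedness is required of the covering sets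
  because \<^const>\<open>diameter\<close> is meaningful for bounded sets only.\<close>

definition hausdorff_gauge :: "nat \<Rightarrow> 'a::metric_space set \<Rightarrow> real" where
  "hausdorff_gauge s C = (if C = {} then 0 else unit_ball_vol (real s) * (diameter C / 2) ^ s)"

definition hausdorff_pre :: "nat \<Rightarrow> real \<Rightarrow> 'a::metric_space set \<Rightarrow> ennreal" where
  "hausdorff_pre s \<delta> A =
    (INF C \<in> {C :: nat \<Rightarrow> 'a set. A \<subseteq> (\<Union>i. C i) \<and> (\<forall>i. bounded (C i) \<and> diameter (C i) \<le> \<delta>)}.
       \<Sum>i. ennreal (hausdorff_gauge s (C i)))"

definition hausdorff_outer :: "nat \<Rightarrow> 'a::metric_space set \<Rightarrow> ennreal" where
  "hausdorff_outer s A = (SUP \<delta> \<in> {0<..}. hausdorff_pre s \<delta> A)"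

text \<open>\<^const>\<open>lambda_system\<close> is the sigma-algebra of the Caratheodory-measurable sets; it contains all
  Borel sets.\<close>

definition hausdorff_measure :: "nat \<Rightarrow> 'a::metric_space measure" where
  "hausdorff_measure s =
    measure_of UNIV (lambda_system UNIV UNIV (hausdorff_outer s)) (hausdorff_outer s)"

definition surface :: "'a::euclidean_space set \<Rightarrow> 'a measure" where
  "surface \<Gamma> = restrict_space (hausdorff_measure (DIM('a) - 1)) \<Gamma>"

text \<open>Near each of its boundary points the set is the part of the space above the graph, in some
  unit direction \<open>e\<close>, of a Lipschitz function \<open>g\<close> on the orthogonal complement of \<open>e\<close>.\<close>

definition lipschitz_boundary :: "'a::euclidean_space set \<Rightarrow> bool" where
  "lipschitz_boundary \<Omega> \<longleftrightarrow>
    (\<forall>x \<in> frontier \<Omega>. \<exists>U e g L. open U \<and> x \<in> U \<and> norm e = 1 \<and>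
       lipschitz_on L {y. e \<bullet> y = 0} g \<and>
       \<Omega> \<inter> U = {y \<in> U. g (y - (e \<bullet> y) *\<^sub>R e) < e \<bullet> y})"

definition polyhedral_set :: "'a::euclidean_space set \<Rightarrow> bool" where
  "polyhedral_set \<Omega> \<longleftrightarrow> (\<exists>\<P>. finite \<P> \<and> (\<forall>P \<in> \<P>. polytope P) \<and> closure \<Omega> = \<Union>\<P>)"

definition bounded_polyhedral_lipschitz_domain :: "'a::euclidean_space set \<Rightarrow> bool" where
  "bounded_polyhedral_lipschitz_domain \<Omega> \<longleftrightarrow>
    open \<Omega> \<and> connected \<Omega> \<and> \<Omega> \<noteq> {} \<and> bounded \<Omega> \<and> polyhedral_set \<Omega> \<and> lipschitz_boundary \<Omega>"

text \<open>Conformity is part of \<^const>\<open>triangulation\<close>: two elements meet in a (possibly empty) common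
  face.\<close>

definition triangulation_of :: "'a::euclidean_space set \<Rightarrow> 'a set set \<Rightarrow> bool" where
  "triangulation_of \<Omega> \<T> \<longleftrightarrow>
    triangulation \<T> \<and> (\<forall>T \<in> \<T>. int DIM('a) simplex T) \<and> \<Union>\<T> = closure \<Omega>"

definition inball_diameter :: "'a::euclidean_space set \<Rightarrow> real" where
  "inball_diameter T = Sup {2 * r | x r. 0 \<le> r \<and> cball x r \<subseteq> T}"

definition shape_regular :: "'a::euclidean_space set set set \<Rightarrow> bool" where
  "shape_regular \<TT> \<longleftrightarrow>
    (\<exists>\<sigma>>0. \<forall>\<T> \<in> \<TT>. \<forall>T \<in> \<T>. diameter T \<le> \<sigma> * inball_diameter T)"

definition mesh_nodes :: "'a::euclidean_space set set \<Rightarrow> 'a set" where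
  "mesh_nodes \<T> = {z. \<exists>T \<in> \<T>. z extreme_point_of T}"

definition boundary_facets :: "'a::euclidean_space set \<Rightarrow> 'a set set \<Rightarrow> 'a set set" where
  "boundary_facets \<Omega> \<T> = {F. F \<subseteq> frontier \<Omega> \<and> (\<exists>T \<in> \<T>. F facet_of T)}"

definition facets_on ::
    "'a::euclidean_space set \<Rightarrow> 'a set set \<Rightarrow> 'a set \<Rightarrow> 'a set set" where
  "facets_on \<Omega> \<T> \<Gamma> = {F \<in> boundary_facets \<Omega> \<T>. F \<subseteq> closure \<Gamma>}"

text \<open>Functions on \<open>closure \<Gamma>\<close> are encoded as \<^const>\<open>extensional\<close> functions, so that an element of
  the finite element space is determined by its values on \<open>closure \<Gamma>\<close>.\<close>

definition S1 ::
    "'a::euclidean_space set \<Rightarrow> 'a set set \<Rightarrow> 'a set \<Rightarrow> ('a \<Rightarrow> real) set" where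
  "S1 \<Omega> \<T> \<Gamma> = {v \<in> extensional (closure \<Gamma>). continuous_on (closure \<Gamma>) v \<and>
      (\<forall>F \<in> facets_on \<Omega> \<T> \<Gamma>. \<exists>a b. \<forall>x \<in> F. v x = a \<bullet> x + b)}"

definition nodal_interp ::
    "'a::euclidean_space set \<Rightarrow> 'a set set \<Rightarrow> 'a set \<Rightarrow> ('a \<Rightarrow> real) \<Rightarrow> 'a \<Rightarrow> real" where
  "nodal_interp \<Omega> \<T> \<Gamma> v =
    (THE w. w \<in> S1 \<Omega> \<T> \<Gamma> \<and> (\<forall>z \<in> mesh_nodes \<T> \<inter> closure \<Gamma>. w z = v z))"

definition ip :: "'a::euclidean_space set \<Rightarrow> ('a \<Rightarrow> real) \<Rightarrow> ('a \<Rightarrow> real) \<Rightarrow> real" where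
  "ip \<Gamma> v w = (LINT x|surface \<Gamma>. v x * w x)"

definition lumped_ip ::
    "'a::euclidean_space set \<Rightarrow> 'a set set \<Rightarrow> 'a set \<Rightarrow> ('a \<Rightarrow> real) \<Rightarrow> ('a \<Rightarrow> real) \<Rightarrow> real" where
  "lumped_ip \<Omega> \<T> \<Gamma> v w = ip \<Gamma> (nodal_interp \<Omega> \<T> \<Gamma> (\<lambda>x. v x * w x)) (\<lambda>_. 1)"

definition L1_norm :: "'a::euclidean_space set \<Rightarrow> ('a \<Rightarrow> real) \<Rightarrow> real" where
  "L1_norm \<Gamma> v = (LINT x|surface \<Gamma>. \<bar>v x\<bar>)"

text \<open>Elements of the Lebesgue spaces are represented by functions, of which only the values on \<open>\<Gamma>\<close>
  matter.\<close>

definition L1_space :: "'a::euclidean_space set \<Rightarrow> ('a \<Rightarrow> real) set" where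
  "L1_space \<Gamma> = {\<eta>. integrable (surface \<Gamma>) \<eta>}"

definition L2_space :: "'a::euclidean_space set \<Rightarrow> ('a \<Rightarrow> real) set" where
  "L2_space \<Gamma> = {\<eta> \<in> borel_measurable (surface \<Gamma>). integrable (surface \<Gamma>) (\<lambda>x. (\<eta> x)\<^sup>2)}"

definition lumped_projection ::
    "'a::euclidean_space set \<Rightarrow> 'a set set \<Rightarrow> 'a set \<Rightarrow> ('a \<Rightarrow> real) \<Rightarrow> 'a \<Rightarrow> real" where
  "lumped_projection \<Omega> \<T> \<Gamma> \<eta> =
    (THE p. p \<in> S1 \<Omega> \<T> \<Gamma> \<and> (\<forall>\<mu> \<in> S1 \<Omega> \<T> \<Gamma>. lumped_ip \<Omega> \<T> \<Gamma> p \<mu> = ip \<Gamma> \<eta> \<mu>))"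

definition mass_set :: "'a::euclidean_space set \<Rightarrow> real \<Rightarrow> ('a \<Rightarrow> real) set" where
  "mass_set \<Gamma> m = {\<eta> \<in> L2_space \<Gamma>. (AE x in surface \<Gamma>. 0 \<le> \<eta> x) \<and> ip \<Gamma> \<eta> (\<lambda>_. 1) = m}"

definition discrete_mass_set ::
    "'a::euclidean_space set \<Rightarrow> 'a set set \<Rightarrow> 'a set \<Rightarrow> real \<Rightarrow> ('a \<Rightarrow> real) set" where
  "discrete_mass_set \<Omega> \<T> \<Gamma> m =
    {\<eta> \<in> S1 \<Omega> \<T> \<Gamma>. (\<forall>x \<in> \<Gamma>. 0 \<le> \<eta> x) \<and> lumped_ip \<Omega> \<T> \<Gamma> \<eta> (\<lambda>_. 1) = m}"

end

theory Submission
  imports Defs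
begin

text \<open>Every element of the finite element space is the combination of the hat functions \<open>\<phi>\<^sub>z\<close> of the
  nodes with its nodal values, so mass lumping diagonalises the problem:
  \<open>\<Pi> \<eta> = (\<Sum>z. ((\<eta>, \<phi>\<^sub>z) / (\<phi>\<^sub>z, 1)) * \<phi>\<^sub>z)\<close>. As \<open>\<phi>\<^sub>z \<ge> 0\<close>, this is nonnegative for \<open>\<eta> \<ge> 0\<close>, and since the hat
  functions sum to one, its integral is that of \<open>\<eta>\<close>.

  The weights \<open>(\<phi>\<^sub>z, 1)\<close> must be finite and positive, although the surface \<open>\<Gamma>\<close> may have smaller measure
  than its closure. This follows from Caratheodory's criterion for the Hausdorff measure, the
  finiteness of the measure of a facet, and the positivity of the measure of a relatively open part of
  a facet. Nodal interpolation is well defined because two facets meet in a common face of both, which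
  is the convex hull of its extreme points, where the affine pieces agree.\<close>

subsection \<open>Hausdorff measure\<close>

lemma hausdorff_pre_le:
  assumes "A \<subseteq> (\<Union>i. C i)" "\<And>i. bounded (C i)" "\<And>i. diameter (C i) \<le> \<delta>"
  shows "hausdorff_pre s \<delta> A \<le> (\<Sum>i. ennreal (hausdorff_gauge s (C i)))"
  unfolding hausdorff_pre_def by (rule INF_lower) (use assms in auto)

lemma hausdorff_pre_empty:
  assumes "0 < \<delta>"
  shows "hausdorff_pre s \<delta> {} = 0"
proof -
  show ?thesis
    using hausdorff_pre_le[of "{}" "\<lambda>_. {}" \<delta> s] assms by (simp add: hausdorff_gauge_def)
qed

lemma hausdorff_pre_mono:
  assumes "A \<subseteq> B"
  shows "hausdorff_pre s \<delta> A \<le> hausdorff_pre s \<delta> B"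
  unfolding hausdorff_pre_def by (rule INF_superset_mono) (use assms in auto)

lemma hausdorff_pre_antimono:
  assumes "\<delta> \<le> \<delta>'"
  shows "hausdorff_pre s \<delta>' A \<le> hausdorff_pre s \<delta> A"
  unfolding hausdorff_pre_def by (rule INF_superset_mono) (auto intro: order_trans[OF _ assms])

lemma hausdorff_pre_approx:
  assumes "hausdorff_pre s \<delta> A < a"
  obtains C where "A \<subseteq> (\<Union>i. C i)" "\<And>i. bounded (C i)" "\<And>i. diameter (C i) \<le> \<delta>"
    "(\<Sum>i. ennreal (hausdorff_gauge s (C i))) < a"
  using assms unfolding hausdorff_pre_def INF_less_iff by auto

text \<open>Covers of the \<open>A i\<close> that are optimal up to \<open>e / 2 ^ (i + 1)\<close>
  merge into one cover through the pairing function, with total excess \<open>e\<close>.\<close>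

lemma hausdorff_pre_countably_subadditive:
  "hausdorff_pre s \<delta> (\<Union>i. A i) \<le> (\<Sum>i. hausdorff_pre s \<delta> (A i))"
proof (rule ennreal_le_epsilon)
  fix e :: real assume e: "0 < e" and fin: "(\<Sum>i. hausdorff_pre s \<delta> (A i)) < top"
  define a where "a i = hausdorff_pre s \<delta> (A i) + ennreal (e * (1/2) ^ Suc i)" for i
  have "hausdorff_pre s \<delta> (A i) < a i" for i
  proof -
    have "hausdorff_pre s \<delta> (A i) \<noteq> top"
      using ennreal_suminf_lessD[OF fin] by (metis less_irrefl)
    then show ?thesis
      using ennreal_add_left_cancel_less[of "hausdorff_pre s \<delta> (A i)" 0 "ennreal (e * (1/2) ^ Suc i)"] e
      by (simp add: a_def)
  qed
  then have "\<exists>C. A i \<subseteq> (\<Union>j. C j) \<and> (\<forall>j. bounded (C j) \<and> diameter (C j) \<le> \<delta>) \<and>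
      (\<Sum>j. ennreal (hausdorff_gauge s (C j))) < a i" for i
    by (metis hausdorff_pre_approx)
  then obtain C where C: "\<And>i. A i \<subseteq> (\<Union>j. C i j)"
      "\<And>i j. bounded (C i j)" "\<And>i j. diameter (C i j) \<le> \<delta>"
      "\<And>i. (\<Sum>j. ennreal (hausdorff_gauge s (C i j))) < a i"
    by metis
  define D where "D n = (case prod_decode n of (i, j) \<Rightarrow> C i j)" for n
  have "(\<Union>i. A i) \<subseteq> (\<Union>n. D n)"
  proof
    fix x assume "x \<in> (\<Union>i. A i)"
    then obtain i j where "x \<in> C i j" using C(1) by blast
    then have "x \<in> D (prod_encode (i, j))" by (simp add: D_def)
    then show "x \<in> (\<Union>n. D n)" by blast
  qed
  then have "hausdorff_pre s \<delta> (\<Union>i. A i) \<le> (\<Sum>n. ennreal (hausdorff_gauge s (D n)))"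
    by (rule hausdorff_pre_le) (auto simp: D_def C split: prod.split)
  also have "\<dots> = (\<Sum>n. (\<lambda>(i, j). ennreal (hausdorff_gauge s (C i j))) (prod_decode n))"
    by (intro suminf_cong) (simp add: D_def split: prod.split)
  also have "\<dots> = (\<Sum>i. \<Sum>j. ennreal (hausdorff_gauge s (C i j)))"
    by (rule suminf_ennreal_2dimen) simp
  also have "\<dots> \<le> (\<Sum>i. a i)"
    using C(4) by (intro suminf_le) (auto intro: less_imp_le)
  also have "\<dots> = (\<Sum>i. hausdorff_pre s \<delta> (A i)) + (\<Sum>i. ennreal (e * (1/2) ^ Suc i))"
    unfolding a_def by (rule suminf_add[symmetric]) auto
  also have "(\<Sum>i. ennreal (e * (1/2) ^ Suc i)) = ennreal e"
    using e power_half_series[THEN sums_mult, of e]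
    by (subst suminf_ennreal2) (auto simp: sums_iff)
  finally show "hausdorff_pre s \<delta> (\<Union>i. A i) \<le> (\<Sum>i. hausdorff_pre s \<delta> (A i)) + ennreal e" .
qed

lemma hausdorff_outer_mono: "A \<subseteq> B \<Longrightarrow> hausdorff_outer s A \<le> hausdorff_outer s B"
  by (auto simp: hausdorff_outer_def intro!: SUP_mono hausdorff_pre_mono)

text \<open>Countable subadditivity holds at every scale \<open>\<delta>\<close>; bounding each term
  by its supremum over the scales carries it over to the limit.\<close>

lemma outer_measure_space_hausdorff_outer:
  "outer_measure_space UNIV (hausdorff_outer s :: 'a::metric_space set \<Rightarrow> ennreal)"
  unfolding outer_measure_space_def
proof (intro conjI)
  show "positive UNIV (hausdorff_outer s)"
    by (simp add: positive_def hausdorff_outer_def hausdorff_pre_empty)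
  show "increasing UNIV (hausdorff_outer s)"
    by (simp add: increasing_def hausdorff_outer_mono)
  have "hausdorff_outer s (\<Union>i. A i) \<le> (\<Sum>i. hausdorff_outer s (A i))" for A :: "nat \<Rightarrow> 'a set"
    unfolding hausdorff_outer_def
  proof (rule SUP_least)
    fix \<delta> :: real assume \<delta>: "\<delta> \<in> {0<..}"
    have "hausdorff_pre s \<delta> (\<Union>i. A i) \<le> (\<Sum>i. hausdorff_pre s \<delta> (A i))"
      by (rule hausdorff_pre_countably_subadditive)
    also have "\<dots> \<le> (\<Sum>i. SUP \<delta>\<in>{0<..}. hausdorff_pre s \<delta> (A i))"
      by (intro suminf_le SUP_upper \<delta> summableI)
    finally show "hausdorff_pre s \<delta> (\<Union>i. A i) \<le> (\<Sum>i. SUP \<delta>\<in>{0<..}. hausdorff_pre s \<delta> (A i))" .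
  qed
  then show "countably_subadditive UNIV (hausdorff_outer s :: 'a set \<Rightarrow> ennreal)"
    by (auto simp: countably_subadditive_def)
qed

section \<open>Additivity on separated sets and Caratheodory's criterion\<close>

lemma hausdorff_pre_metric_additive:
  fixes A B :: "'a::metric_space set"
  assumes sep: "\<And>x y. x \<in> A \<Longrightarrow> y \<in> B \<Longrightarrow> \<delta> < dist x y" and \<delta>: "0 < \<delta>"
  shows "hausdorff_pre s \<delta> A + hausdorff_pre s \<delta> B \<le> hausdorff_pre s \<delta> (A \<union> B)"
  unfolding hausdorff_pre_def[of s \<delta> "A \<union> B"]
proof (rule INF_greatest, clarify)
  fix C :: "nat \<Rightarrow> 'a set"
  assume C: "A \<union> B \<subseteq> (\<Union>i. C i)" "\<forall>i. bounded (C i) \<and> diameter (C i) \<le> \<delta>"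
  \<comment> \<open>\<open>D P\<close> keeps the cells that meet \<open>P\<close>. A cell of
    diameter at most \<open>\<delta>\<close> cannot meet both \<open>A\<close> and \<open>B\<close>,
    so the cover splits in two and no gauge is counted twice.\<close>
  define D where "D P i = (if C i \<inter> P = {} then {} else C i)" for P i
  have D: "bounded (D P i)" "diameter (D P i) \<le> \<delta>" for P i
    using C(2) \<delta> by (auto simp: D_def)
  have "D A i = {} \<or> D B i = {}" for i
  proof (rule ccontr)
    assume "\<not> ?thesis"
    then obtain x y where "x \<in> A" "y \<in> B" "x \<in> C i" "y \<in> C i"
      by (auto simp: D_def split: if_splits)
    then show False
      using sep[of x y] C(2)[rule_format, of i] diameter_bounded_bound[of "C i" x y] by linarith
  qed
  moreover have "ennreal (hausdorff_gauge s (D P i)) \<le> ennreal (hausdorff_gauge s (C i))" for P i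
    by (auto simp: D_def hausdorff_gauge_def)
  moreover have "hausdorff_gauge s ({} :: 'a set) = 0" by (simp add: hausdorff_gauge_def)
  ultimately have le: "ennreal (hausdorff_gauge s (D A i)) + ennreal (hausdorff_gauge s (D B i))
      \<le> ennreal (hausdorff_gauge s (C i))" for i
    by (metis add.left_neutral add.right_neutral ennreal_0)
  have "hausdorff_pre s \<delta> A + hausdorff_pre s \<delta> B \<le>
      (\<Sum>i. ennreal (hausdorff_gauge s (D A i))) + (\<Sum>i. ennreal (hausdorff_gauge s (D B i)))"
  proof (intro add_mono hausdorff_pre_le D)
    show "A \<subseteq> (\<Union>i. D A i)" "B \<subseteq> (\<Union>i. D B i)"
      using C(1) unfolding D_def by fastforce+
  qed
  also have "\<dots> = (\<Sum>i. ennreal (hausdorff_gauge s (D A i)) + ennreal (hausdorff_gauge s (D B i)))"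
    by (rule suminf_add) auto
  also have "\<dots> \<le> (\<Sum>i. ennreal (hausdorff_gauge s (C i)))"
    by (intro suminf_le le summableI)
  finally show "hausdorff_pre s \<delta> A + hausdorff_pre s \<delta> B \<le> \<dots>" .
qed

lemma hausdorff_outer_metric_additive:
  assumes sep: "\<And>x y. x \<in> A \<Longrightarrow> y \<in> B \<Longrightarrow> e \<le> dist x y" and e: "0 < e"
  shows "hausdorff_outer s A + hausdorff_outer s B \<le> hausdorff_outer s (A \<union> B)"
proof -
  have "hausdorff_pre s \<delta> A + hausdorff_pre s \<delta>' B \<le> hausdorff_outer s (A \<union> B)"
    if "\<delta> > 0" "\<delta>' > 0" for \<delta> \<delta>'
  proof -
    \<comment> \<open>Halving \<open>e\<close> turns the weak separation into the strict one
      required at scale \<open>d\<close>; a scale below both \<open>\<delta>\<close> and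
      \<open>\<delta>'\<close> can only increase the two terms.\<close>
    define d where "d = min (e / 2) (min \<delta> \<delta>')"
    have d: "0 < d" "d < e" "d \<le> \<delta>" "d \<le> \<delta>'" using that e by (auto simp: d_def)
    have "hausdorff_pre s \<delta> A + hausdorff_pre s \<delta>' B \<le> hausdorff_pre s d A + hausdorff_pre s d B"
      by (intro add_mono hausdorff_pre_antimono d)
    also have "\<dots> \<le> hausdorff_pre s d (A \<union> B)"
      by (rule hausdorff_pre_metric_additive) (use sep d in force)+
    also have "\<dots> \<le> hausdorff_outer s (A \<union> B)"
      unfolding hausdorff_outer_def by (rule SUP_upper) (use d in auto)
    finally show ?thesis .
  qed
  then have "(SUP \<delta>\<in>{0<..}. hausdorff_pre s \<delta> A + (SUP \<delta>'\<in>{0<..}. hausdorff_pre s \<delta>' B))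
      \<le> hausdorff_outer s (A \<union> B)"
    by (auto simp: ennreal_SUP_add_right intro!: SUP_least)
  then show ?thesis
    unfolding hausdorff_outer_def[of s A] hausdorff_outer_def[of s B]
    by (subst ennreal_SUP_add_left[symmetric]) auto
qed

text \<open>Caratheodory's criterion: \<open>X - S\<close> is exhausted by the sets \<open>E n\<close> of its points at distance at least
  \<open>1 / (n + 1)\<close> from \<open>S\<close>. The rings \<open>E (Suc n) - E n\<close> of equal parity are separated from each other, so
  the measures of all rings sum to at most \<open>2 * f X\<close> and their tails vanish.\<close>

lemma lambda_system_metric_outer_measure:
  fixes f :: "'a::metric_space set \<Rightarrow> ennreal"
  assumes outer: "outer_measure_space UNIV f"
    and sep: "\<And>A B e. 0 < e \<Longrightarrow> (\<And>x y. x \<in> A \<Longrightarrow> y \<in> B \<Longrightarrow> e \<le> dist x y) \<Longrightarrow> f A + f B \<le> f (A \<union> B)"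
    and S: "closed S"
  shows "S \<in> lambda_system UNIV UNIV f"
proof -
  have pos: "positive UNIV f" and mono: "\<And>A B. A \<subseteq> B \<Longrightarrow> f A \<le> f B"
    and csub: "countably_subadditive UNIV f"
    using outer by (auto simp: outer_measure_space_def increasing_def)
  have f0: "f {} = 0" using pos by (simp add: positive_def)
  interpret sigma_algebra UNIV "UNIV :: 'a set set"
    by (rule sigma_algebra_Pow[of UNIV, simplified])
  have sub: "f (A \<union> B) \<le> f A + f B" for A B
  proof -
    have "f (A \<union> (B - A)) \<le> f A + f (B - A)"
      using countably_subadditive_subadditive[OF pos csub] by (rule subadditiveD) auto
    also have "\<dots> \<le> f A + f B" by (intro add_left_mono mono) auto
    finally show ?thesis by simp
  qed
  have csub': "f (\<Union>i. A i) \<le> (\<Sum>i. f (A i))" if "disjoint_family A" for A :: "nat \<Rightarrow> 'a set"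
    using csub that by (auto simp: countably_subadditive_def)
  \<comment> \<open>\<open>infdist\<close> to the empty set is 0 by convention, so the case
    \<open>S = {}\<close> is kept apart. It is trivial, as is \<open>f X = top\<close>; both are
    settled at the end.\<close>
  have main: "f (S \<inter> X) + f (X - S) \<le> f X" if ne: "S \<noteq> {}" and fin: "f X < top" for X
  proof -
    define E where "E n = {x \<in> X. inverse (real (Suc n)) \<le> infdist x S}" for n
    define R where "R n = E (Suc n) - E n" for n
    have E_mono: "E n \<subseteq> E m" if "n \<le> m" for n m
    proof -
      have "inverse (real (Suc m)) \<le> inverse (real (Suc n))"
        using that by (intro le_imp_inverse_le) auto
      then show ?thesis unfolding E_def by (blast intro: order_trans)
    qed
    have disj: "disjoint_family R"
      unfolding R_def using E_mono by (intro disjoint_family_Suc) auto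
    have dist_le: "infdist x S - infdist y S \<le> dist x y" for x y
      using infdist_triangle[of x S y] by simp
    have half: "(\<Sum>k<n. f (R (2 * k + j))) \<le> f (\<Union>k<n. R (2 * k + j))" for n j
    proof (induction n)
      case (Suc n)
      \<comment> \<open>Points of the earlier rings have distance at least
        \<open>1 / (2 * n + j)\<close> from \<open>S\<close>, points of the new ring less than
        \<open>1 / (2 * n + j + 1)\<close>; \<open>?e\<close> is the gap. It is positive only away
        from \<open>2 * n + j = 0\<close>, and for \<open>n = 0\<close> there are no earlier
        rings.\<close>
      let ?e = "inverse (real (2 * n + j)) - inverse (real (Suc (2 * n + j)))"
      have "f (\<Union>k<n. R (2 * k + j)) + f (R (2 * n + j)) \<le> f ((\<Union>k<n. R (2 * k + j)) \<union> R (2 * n + j))"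
      proof (cases "n = 0")
        case False
        show ?thesis
        proof (rule sep[where e = ?e])
          show "0 < ?e" using False by (simp add: less_imp_inverse_less)
          fix x y assume "x \<in> (\<Union>k<n. R (2 * k + j))" and y: "y \<in> R (2 * n + j)"
          then obtain k where k: "k < n" "x \<in> E (Suc (2 * k + j))" by (auto simp: R_def)
          moreover have "Suc (2 * k + j) \<le> 2 * n + j - 1" using k(1) by linarith
          ultimately have "x \<in> E (2 * n + j - 1)" using E_mono by blast
          then have "inverse (real (2 * n + j)) \<le> infdist x S" using False by (simp add: E_def)
          moreover have "infdist y S < inverse (real (Suc (2 * n + j)))"
            using y by (auto simp: R_def E_def)
          ultimately show "?e \<le> dist x y" using dist_le[of x y] by linarith
        qed
      qed (simp add: f0)
      also have "(\<Union>k<n. R (2 * k + j)) \<union> R (2 * n + j) = (\<Union>k<Suc n. R (2 * k + j))"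
        by (auto simp: lessThan_Suc)
      finally show ?case using Suc.IH by (auto intro: order_trans add_right_mono)
    qed (simp add: f0)
    have RX: "(\<Union>k<n. R (2 * k + j)) \<subseteq> X" for n j by (auto simp: R_def E_def)
    have "(\<Sum>k<n. f (R k)) \<le> f X + f X" for n
    proof -
      have "(\<Sum>k<n. f (R k)) \<le> (\<Sum>k<2 * n. f (R k))"
        by (rule sum_mono2) auto
      also have "\<dots> = (\<Sum>k<n. f (R (2 * k + 0))) + (\<Sum>k<n. f (R (2 * k + 1)))"
        by (induction n) (simp_all add: ac_simps)
      also have "\<dots> \<le> f X + f X"
        by (intro add_mono order_trans[OF half mono[OF RX]])
      finally show ?thesis .
    qed
    then have "(\<Sum>k. f (R k)) \<le> f X + f X" by (intro suminf_le_const) auto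
    then have fin': "(\<Sum>k. f (R k)) < top"
      using fin by (meson ennreal_add_less_top order_le_less_trans)
    define r where "r k = enn2real (f (R k))" for k
    have fr: "f (R k) = ennreal (r k)" for k
      unfolding r_def using ennreal_suminf_lessD[OF fin'] by simp
    have r0: "0 \<le> r k" for k by (simp add: r_def)
    have sumr: "summable r"
      using fin' r0 unfolding fr by (intro summable_suminf_not_top) auto
    show ?thesis
    proof (rule ennreal_le_epsilon)
      fix e :: real assume "0 < e"
      then obtain n where n: "norm (\<Sum>k. r (k + n)) < e"
        using suminf_exist_split[OF _ sumr] by blast
      have "X - S \<subseteq> E n \<union> (\<Union>k. R (k + n))"
      proof
        fix x assume x: "x \<in> X - S"
        then have "0 < infdist x S"
          using S ne by (metis DiffD2 in_closed_iff_infdist_zero infdist_nonneg less_eq_real_def)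
        then obtain m where m: "inverse (real (Suc m)) < infdist x S"
          using reals_Archimedean by blast
        \<comment> \<open>The first \<open>E l\<close> to contain \<open>x\<close> decides: if
          \<open>l \<le> n\<close> then \<open>x\<close> lies in \<open>E n\<close>, otherwise in
          the ring just below index \<open>l\<close>, which belongs to the tail.\<close>
        define l where "l = (LEAST l. x \<in> E l)"
        have "x \<in> E m" using x m by (simp add: E_def)
        then have l: "x \<in> E l" unfolding l_def by (rule LeastI)
        show "x \<in> E n \<union> (\<Union>k. R (k + n))"
        proof (cases "l \<le> n")
          case True
          then show ?thesis using l E_mono by blast
        next
          case False
          then obtain k where k: "l = Suc (k + n)" by (metis add.commute less_iff_Suc_add not_le)
          then have "x \<notin> E (k + n)" using not_less_Least[of "k + n" "\<lambda>l. x \<in> E l"] l_def by auto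
          then have "x \<in> R (k + n)" using l k by (simp add: R_def)
          then show ?thesis by blast
        qed
      qed
      then have "f (X - S) \<le> f (E n \<union> (\<Union>k. R (k + n)))" by (rule mono)
      also have "\<dots> \<le> f (E n) + f (\<Union>k. R (k + n))" by (rule sub)
      also have "f (\<Union>k. R (k + n)) \<le> (\<Sum>k. f (R (k + n)))"
        using disj by (intro csub') (auto simp: disjoint_family_on_def)
      also have "\<dots> = ennreal (\<Sum>k. r (k + n))"
        unfolding fr by (rule suminf_ennreal2) (use r0 sumr in \<open>auto simp: summable_iff_shift\<close>)
      also have "\<dots> \<le> ennreal e" using n by (intro ennreal_leI) auto
      finally have "f (S \<inter> X) + f (X - S) \<le> f (S \<inter> X) + (f (E n) + ennreal e)"
        by (auto intro: add_left_mono)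
      also have "\<dots> = (f (S \<inter> X) + f (E n)) + ennreal e" by (simp add: ac_simps)
      also have "f (S \<inter> X) + f (E n) \<le> f (S \<inter> X \<union> E n)"
      proof (rule sep[where e = "inverse (real (Suc n))"])
        fix x y assume "x \<in> S \<inter> X" "y \<in> E n"
        then show "inverse (real (Suc n)) \<le> dist x y"
          using dist_le[of y x] by (auto simp: E_def dist_commute)
      qed simp
      also have "\<dots> \<le> f X" by (rule mono) (auto simp: E_def)
      finally show "f (S \<inter> X) + f (X - S) \<le> f X + ennreal e" by (auto intro: add_right_mono)
    qed
  qed
  have "f (S \<inter> X) + f ((UNIV - S) \<inter> X) = f X" for X
  proof (rule antisym)
    have "f ((S \<inter> X) \<union> ((UNIV - S) \<inter> X)) \<le> f (S \<inter> X) + f ((UNIV - S) \<inter> X)" by (rule sub)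
    also have "(S \<inter> X) \<union> ((UNIV - S) \<inter> X) = X" by auto
    finally show "f X \<le> f (S \<inter> X) + f ((UNIV - S) \<inter> X)" .
    have eq: "(UNIV - S) \<inter> X = X - S" by auto
    show "f (S \<inter> X) + f ((UNIV - S) \<inter> X) \<le> f X"
      unfolding eq using main[of X] by (cases "S = {}"; cases "f X = top") (auto simp: f0 less_top)
  qed
  then show ?thesis by (simp add: lambda_system_def)
qed

section \<open>The Hausdorff measure on a sigma-algebra containing the Borel sets\<close>

lemma measure_space_hausdorff:
  "measure_space UNIV (lambda_system UNIV UNIV (hausdorff_outer s)) (hausdorff_outer s)"
proof -
  interpret sigma_algebra UNIV "UNIV :: 'a set set"
    by (rule sigma_algebra_Pow[of UNIV, simplified])
  show ?thesis by (rule caratheodory_lemma) (rule outer_measure_space_hausdorff_outer)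
qed

lemma space_hausdorff_measure [simp]: "space (hausdorff_measure s) = UNIV"
  unfolding hausdorff_measure_def by (rule space_measure_of) auto

lemma sets_hausdorff_measure: "sets (hausdorff_measure s) = lambda_system UNIV UNIV (hausdorff_outer s)"
proof -
  interpret sigma_algebra UNIV "lambda_system UNIV UNIV (hausdorff_outer s)"
    using measure_space_hausdorff unfolding measure_space_def by blast
  show ?thesis unfolding hausdorff_measure_def by (simp add: sigma_sets_eq)
qed

lemma emeasure_hausdorff_measure:
  assumes "A \<in> sets (hausdorff_measure s)"
  shows "emeasure (hausdorff_measure s) A = hausdorff_outer s A"
  unfolding hausdorff_measure_def
proof (rule emeasure_measure_of_sigma)
  show "A \<in> lambda_system UNIV UNIV (hausdorff_outer s)"
    using assms by (simp add: sets_hausdorff_measure)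
qed (use measure_space_hausdorff in \<open>auto simp: measure_space_def\<close>)

text \<open>Closed sets are measurable by Caratheodory's criterion, hence so are their complements,
  which generate the Borel sets.\<close>

lemma sets_borel_subset_hausdorff_measure:
  "sets borel \<subseteq> sets (hausdorff_measure s :: 'a::metric_space measure)"
proof -
  have "S \<in> sets (hausdorff_measure s)" if "closed S" for S :: "'a set"
    unfolding sets_hausdorff_measure
    by (rule lambda_system_metric_outer_measure[OF outer_measure_space_hausdorff_outer _ that])
      (rule hausdorff_outer_metric_additive)
  then have "- (- S) \<in> sets (hausdorff_measure s)" if "open S" for S :: "'a set"
    using that sets.compl_sets[of "- S" "hausdorff_measure s"] by (auto simp: Compl_eq_Diff_UNIV closed_Compl[unfolded Compl_eq_Diff_UNIV])
  then have "{S :: 'a set. open S} \<subseteq> sets (hausdorff_measure s)" by auto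
  from sets.sigma_sets_subset[OF this] show ?thesis by (simp add: borel_def)
qed

subsection \<open>Size of simplices and of relatively open pieces of hyperplanes\<close>

lemma hausdorff_gauge_le:
  assumes "bounded C" "diameter C \<le> d" "0 \<le> d"
  shows "hausdorff_gauge s C \<le> unit_ball_vol (real s) * (d / 2) ^ s"
  using assms diameter_ge_0[of C]
  by (auto simp: hausdorff_gauge_def intro!: mult_left_mono power_mono)

text \<open>The finite family is numbered and padded with empty sets, whose gauge is 0 even for
  \<open>s = 0\<close>.\<close>

lemma hausdorff_pre_le_sum:
  assumes I: "finite I" and A: "A \<subseteq> (\<Union>i\<in>I. C i)"
    and C: "\<And>i. i \<in> I \<Longrightarrow> bounded (C i)" "\<And>i. i \<in> I \<Longrightarrow> diameter (C i) \<le> \<delta>" and \<delta>: "0 < \<delta>"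
  shows "hausdorff_pre s \<delta> A \<le> (\<Sum>i\<in>I. ennreal (hausdorff_gauge s (C i)))"
proof -
  obtain h where h: "bij_betw h {..<card I} I"
    using ex_bij_betw_nat_finite[OF I] by (auto simp: atLeast0LessThan)
  have hI: "h j \<in> I" if "j < card I" for j using h that by (auto simp: bij_betw_def)
  define D where "D j = (if j < card I then C (h j) else {})" for j
  have "hausdorff_pre s \<delta> A \<le> (\<Sum>j. ennreal (hausdorff_gauge s (D j)))"
  proof (rule hausdorff_pre_le)
    show "A \<subseteq> (\<Union>j. D j)"
    proof
      fix x assume "x \<in> A"
      then obtain i where "i \<in> I" "x \<in> C i" using A by blast
      then obtain j where "j < card I" "i = h j" using h by (auto simp: bij_betw_def image_iff)
      then have "x \<in> D j" using \<open>x \<in> C i\<close> by (simp add: D_def)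
      then show "x \<in> (\<Union>j. D j)" by blast
    qed
  qed (use C hI \<delta> in \<open>auto simp: D_def\<close>)
  also have "\<dots> = (\<Sum>j<card I. ennreal (hausdorff_gauge s (D j)))"
    by (rule suminf_finite) (auto simp: D_def hausdorff_gauge_def)
  also have "\<dots> = (\<Sum>j<card I. ennreal (hausdorff_gauge s (C (h j))))"
    by (rule sum.cong) (auto simp: D_def)
  also have "\<dots> = (\<Sum>i\<in>I. ennreal (hausdorff_gauge s (C i)))"
    by (rule sum.reindex_bij_betw[OF h])
  finally show ?thesis .
qed

text \<open>Cutting the range of each barycentric coordinate but one into \<open>n\<close> intervals covers the simplex by
  at most \<open>(n + 1) ^ s\<close> cells of diameter at most \<open>K / n\<close>.\<close>

lemma hausdorff_outer_convex_hull_finite: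
  fixes S :: "'a::euclidean_space set"
  assumes S: "finite S" and c: "c \<in> S"
  shows "hausdorff_outer (card S - 1) (convex hull S) < top"
proof -
  define T where "T = S - {c}"
  define s where "s = card T"
  have T: "finite T" and s: "card S - 1 = s" using S c by (auto simp: T_def s_def)
  \<comment> \<open>Two points whose coordinates on \<open>T\<close> differ by at most
    \<open>1 / n\<close> are at distance at most \<open>K / n\<close>.\<close>
  define K where "K = (\<Sum>x\<in>T. norm (x - c))"
  have K: "0 \<le> K" by (auto simp: K_def intro: sum_nonneg)
  define M where "M = unit_ball_vol (real s) * K ^ s"
  have "hausdorff_pre s \<delta> (convex hull S) \<le> ennreal M" if \<delta>: "0 < \<delta>" for \<delta>
  proof -
    obtain n0 where n0: "K / \<delta> < real n0" using reals_Archimedean2 by blast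
    define n where "n = Suc n0"
    have n: "0 < real n" "1 \<le> n" by (auto simp: n_def)
    have Kn: "K / real n \<le> \<delta>" using n0 \<delta> n by (simp add: n_def field_simps)
    \<comment> \<open>The index \<open>n\<close> is included because a barycentric coordinate may
      equal 1. The coordinate of \<open>c\<close> is the one left out: \<open>P\<close> recovers the
      point from the others.\<close>
    define I where "I = T \<rightarrow>\<^sub>E {..n}"
    define P where "P u = c + (\<Sum>x\<in>T. u x *\<^sub>R (x - c))" for u
    define C where "C k = {P u | u. \<forall>x\<in>T. real (k x) / real n \<le> u x \<and> u x \<le> (real (k x) + 1) / real n}" for k
    have I: "finite I" "card I = (n + 1) ^ s"
      using T by (auto simp: I_def s_def card_funcsetE finite_PiE)
    have dist_C: "norm (y - z) \<le> K / real n" if "y \<in> C k" "z \<in> C k" for y z k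
    proof -
      obtain u v where u: "y = P u" "\<And>x. x \<in> T \<Longrightarrow> real (k x) / real n \<le> u x \<and> u x \<le> (real (k x) + 1) / real n"
        and v: "z = P v" "\<And>x. x \<in> T \<Longrightarrow> real (k x) / real n \<le> v x \<and> v x \<le> (real (k x) + 1) / real n"
        using \<open>y \<in> C k\<close> \<open>z \<in> C k\<close> unfolding C_def by blast
      have "y - z = (\<Sum>x\<in>T. (u x - v x) *\<^sub>R (x - c))"
        by (simp add: u(1) v(1) P_def sum_subtractf scaleR_diff_left)
      then have "norm (y - z) \<le> (\<Sum>x\<in>T. norm ((u x - v x) *\<^sub>R (x - c)))"
        by (simp only: norm_sum)
      also have "\<dots> \<le> (\<Sum>x\<in>T. norm (x - c) / real n)"
      proof (rule sum_mono)
        fix x assume x: "x \<in> T"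
        have "\<bar>u x - v x\<bar> \<le> 1 / real n"
          using u(2)[OF x] v(2)[OF x] by (simp add: abs_le_iff add_divide_distrib)
        then have "\<bar>u x - v x\<bar> * norm (x - c) \<le> 1 / real n * norm (x - c)"
          by (rule mult_right_mono) auto
        then show "norm ((u x - v x) *\<^sub>R (x - c)) \<le> norm (x - c) / real n" by simp
      qed
      finally show ?thesis by (simp add: K_def sum_divide_distrib)
    qed
    have bd: "bounded (C k)" for k
    proof (cases "C k = {}")
      case False
      then obtain y where "y \<in> C k" by blast
      then show ?thesis
        by (intro bounded_subset[OF bounded_cball[of y "K / real n"]])
          (auto simp: dist_norm intro: dist_C)
    qed auto
    have dm: "diameter (C k) \<le> K / real n" for k
      by (rule diameter_le) (use dist_C K in auto)
    have cov: "convex hull S \<subseteq> (\<Union>k\<in>I. C k)"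
    proof
      fix y assume "y \<in> convex hull S"
      then obtain u where u: "\<And>x. x \<in> S \<Longrightarrow> 0 \<le> u x" "sum u S = 1" "(\<Sum>x\<in>S. u x *\<^sub>R x) = y"
        using convex_hull_finite[OF S] by auto
      \<comment> \<open>As the weights sum to 1, the combination may be recentred at
        \<open>c\<close>, where its own term vanishes.\<close>
      have "y = (\<Sum>x\<in>S. u x *\<^sub>R (x - c)) + sum u S *\<^sub>R c"
        by (simp add: u(3) scaleR_diff_right sum_subtractf scaleR_sum_left)
      also have "(\<Sum>x\<in>S. u x *\<^sub>R (x - c)) = (\<Sum>x\<in>T. u x *\<^sub>R (x - c))"
        unfolding T_def using S c by (subst sum.remove[of S c]) auto
      finally have y: "y = P u" by (simp add: P_def u(2) add.commute)
      have u01: "0 \<le> u x" "u x \<le> 1" if "x \<in> T" for x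
        using u(1) member_le_sum[of x S u] S that u(2) by (auto simp: T_def)
      define k where "k = restrict (\<lambda>x. nat \<lfloor>real n * u x\<rfloor>) T"
      have "k \<in> I"
      proof -
        have "nat \<lfloor>real n * u x\<rfloor> \<le> n" if "x \<in> T" for x
        proof -
          have "real n * u x \<le> real n" using u01[OF that] n by (simp add: mult_left_le)
          then show ?thesis by linarith
        qed
        then show ?thesis by (auto simp: k_def I_def)
      qed
      moreover have "y \<in> C k"
      proof -
        have "real (k x) / real n \<le> u x \<and> u x \<le> (real (k x) + 1) / real n" if "x \<in> T" for x
        proof -
          have "0 \<le> real n * u x" using u01[OF that] by simp
          then have "real (k x) \<le> real n * u x \<and> real n * u x \<le> real (k x) + 1"
            using that unfolding k_def restrict_apply by simp
          then show ?thesis using n by (simp add: field_simps)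
        qed
        then show ?thesis unfolding C_def y by blast
      qed
      ultimately show "y \<in> (\<Union>k\<in>I. C k)" by blast
    qed
    have "hausdorff_pre s \<delta> (convex hull S) \<le> (\<Sum>k\<in>I. ennreal (hausdorff_gauge s (C k)))"
      using I(1) cov bd order_trans[OF dm Kn] \<delta> by (intro hausdorff_pre_le_sum)
    also have "\<dots> \<le> (\<Sum>k\<in>I. ennreal (unit_ball_vol (real s) * (K / real n / 2) ^ s))"
      using K n by (intro sum_mono ennreal_leI hausdorff_gauge_le bd dm) auto
    also have "\<dots> = ennreal (real (card I) * (unit_ball_vol (real s) * (K / real n / 2) ^ s))"
      using K n by (simp add: ennreal_mult ennreal_of_nat_eq_real_of_nat)
    also have "\<dots> \<le> ennreal M"
    proof (rule ennreal_leI)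
      \<comment> \<open>There are \<open>(n + 1) ^ s\<close> cells, each with half-diameter at most
        \<open>K / (2 * n)\<close>. Since \<open>n + 1 \<le> 2 * n\<close>, the bound
        \<open>M\<close> does not depend on \<open>\<delta>\<close>.\<close>
      have "real (card I) * (unit_ball_vol (real s) * (K / real n / 2) ^ s) =
          unit_ball_vol (real s) * ((real n + 1) * (K / real n / 2)) ^ s"
        unfolding I(2) power_mult_distrib by (simp add: add.commute)
      also have "\<dots> \<le> M"
        unfolding M_def
      proof (intro mult_left_mono power_mono)
        have "(real n + 1) * K \<le> (2 * real n) * K"
          using n(2) K by (intro mult_right_mono) auto
        then show "(real n + 1) * (K / real n / 2) \<le> K" using n by (simp add: field_simps)
      qed (use K n in auto)
      finally show "real (card I) * (unit_ball_vol (real s) * (K / real n / 2) ^ s) \<le> M" .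
    qed
    finally show ?thesis .
  qed
  then have "hausdorff_outer s (convex hull S) \<le> ennreal M"
    unfolding hausdorff_outer_def by (intro SUP_least) auto
  then show ?thesis unfolding s by (simp add: order_le_less_trans)
qed

text \<open>The unit prism over the disc in a coordinate direction transversal to the hyperplane has
  positive volume, while the prism over a set of diameter \<open>D \<le> 1\<close> fits in a box of volume
  \<open>(2 * D) ^ (DIM('a) - 1) * (2 * D + 1)\<close>.\<close>

lemma hausdorff_outer_hyperplane_ball_pos:
  fixes a x0 :: "'a::euclidean_space"
  assumes a: "a \<noteq> 0" and x0: "a \<bullet> x0 = b" and e: "0 < e"
  shows "0 < hausdorff_outer (DIM('a) - 1) (ball x0 e \<inter> {x. a \<bullet> x = b})"
proof -
  define s where "s = DIM('a) - 1"
  obtain i where i: "i \<in> Basis" "a \<bullet> i \<noteq> 0" using a by (metis euclidean_all_zero_iff)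
  \<comment> \<open>\<open>t y\<close> is the multiple of \<open>i\<close> by which \<open>y\<close>
    lies off the hyperplane, so \<open>y - t y *\<^sub>R i\<close> is its projection along
    \<open>i\<close>. Accordingly \<open>W\<close> is the open unit prism over the disc.\<close>
  define t where "t y = (a \<bullet> y - b) / (a \<bullet> i)" for y
  define W where "W = {y. 0 < t y} \<inter> {y. t y < 1} \<inter> {y. dist x0 (y - t y *\<^sub>R i) < e}"
  have "open W"
    unfolding W_def t_def using i by (intro open_Int open_Collect_less continuous_intros) auto
  moreover have "x0 + (1/2) *\<^sub>R i \<in> W"
    using i x0 e by (simp add: W_def t_def inner_simps)
  ultimately have W: "0 < emeasure lborel W" "W \<in> sets lborel"
    using open_not_negligible[of W]
    by (auto simp: negligible_iff_null_sets null_sets_def zero_less_iff_neq_zero)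
  \<comment> \<open>At scale 1 a cell of diameter \<open>D\<close> has a box of volume at most
    \<open>3 * (2 * D) ^ s = 3 * 4 ^ s * (D / 2) ^ s\<close>; the factor \<open>K\<close> turns this
    into the gauge of the cell.\<close>
  define K where "K = unit_ball_vol (real s) / (3 * 4 ^ s)"
  have K: "0 < K" by (auto simp: K_def)
  let ?A = "ball x0 e \<inter> {x. a \<bullet> x = b}"
  have "ennreal K * emeasure lborel W \<le> hausdorff_pre s 1 ?A"
    unfolding hausdorff_pre_def
  proof (rule INF_greatest, clarify)
    fix C :: "nat \<Rightarrow> 'a set"
    assume C: "?A \<subseteq> (\<Union>j. C j)" "\<forall>j. bounded (C j) \<and> diameter (C j) \<le> 1"
    define p where "p j = (SOME p. p \<in> C j)" for j
    define D where "D j = diameter (C j)" for j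
    have D: "0 \<le> D j" "D j \<le> 1" for j using C(2) by (auto simp: D_def diameter_ge_0)
    \<comment> \<open>The cube about \<open>p j\<close> contains \<open>C j\<close>, and adding
      \<open>i\<close> to its upper corner makes room for the shifts \<open>t y *\<^sub>R i\<close>
      with \<open>t y\<close> between 0 and 1. An empty cell gets the empty box, so the arbitrary
      value of \<open>p j\<close> there does no harm.\<close>
    define Q where "Q j = (if C j = {} then {} else cbox (p j - D j *\<^sub>R One) (p j + D j *\<^sub>R One + i))" for j
    have ib: "i \<bullet> b = (if b = i then 1 else 0)" if "b \<in> Basis" for b
      using i that by (auto simp: inner_Basis)
    have Q: "ennreal K * emeasure lborel (Q j) \<le> ennreal (hausdorff_gauge s (C j))" for j
    proof (cases "C j = {}")
      case False
      have "emeasure lborel (Q j) = ennreal (\<Prod>b\<in>Basis. ((p j + D j *\<^sub>R One + i) - (p j - D j *\<^sub>R One)) \<bullet> b)"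
        using False D[of j] unfolding Q_def if_not_P[OF False]
        by (intro emeasure_lborel_cbox) (simp add: inner_simps ib)
      also have "(\<Prod>b\<in>Basis. ((p j + D j *\<^sub>R One + i) - (p j - D j *\<^sub>R One)) \<bullet> b)
          = (\<Prod>b\<in>Basis. 2 * D j + (if b = i then 1 else 0))"
        by (rule prod.cong) (auto simp: inner_simps ib)
      also have "\<dots> = (2 * D j + 1) * (\<Prod>b\<in>Basis - {i}. 2 * D j)"
        using i by (subst prod.remove[of _ i]) (auto intro!: prod.cong)
      also have "(\<Prod>b\<in>Basis - {i}. 2 * D j) = (2 * D j) ^ s"
        using i by (simp add: s_def)
      finally have "emeasure lborel (Q j) = ennreal ((2 * D j + 1) * (2 * D j) ^ s)" .
      then have "ennreal K * emeasure lborel (Q j) = ennreal (K * ((2 * D j + 1) * (2 * D j) ^ s))"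
        using K D[of j] by (simp add: ennreal_mult)
      also have "\<dots> \<le> ennreal (K * (3 * (2 * D j) ^ s))"
        using K D[of j] by (intro ennreal_leI mult_left_mono mult_right_mono) auto
      also have "K * (3 * (2 * D j) ^ s) = unit_ball_vol (real s) * (D j / 2) ^ s"
      proof -
        have "(2 * D j) ^ s = 4 ^ s * (D j / 2) ^ s" by (subst power_mult_distrib[symmetric]) simp
        then show ?thesis by (simp add: K_def)
      qed
      finally show ?thesis using False by (simp add: hausdorff_gauge_def D_def)
    qed (simp add: Q_def hausdorff_gauge_def)
    have "W \<subseteq> (\<Union>j. Q j)"
    proof
      fix y assume y: "y \<in> W"
      define x where "x = y - t y *\<^sub>R i"
      have "a \<bullet> x = b" using i by (simp add: x_def t_def inner_simps)
      then have "x \<in> ?A" using y by (simp add: W_def x_def)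
      then obtain j where j: "x \<in> C j" using C(1) by blast
      then have "p j \<in> C j" unfolding p_def by (rule someI)
      then have px: "norm (x - p j) \<le> D j"
        using diameter_bounded_bound[of "C j" x "p j"] C(2) j by (auto simp: D_def dist_norm)
      have "y \<in> Q j"
      proof -
        have "p j \<bullet> b - D j \<le> y \<bullet> b \<and> y \<bullet> b \<le> p j \<bullet> b + D j + i \<bullet> b" if b: "b \<in> Basis" for b
        proof -
          have "\<bar>(x - p j) \<bullet> b\<bar> \<le> D j" using Basis_le_norm[OF b, of "x - p j"] px by simp
          moreover have "y \<bullet> b = x \<bullet> b + t y * (i \<bullet> b)" by (simp add: x_def inner_simps)
          moreover have "0 \<le> t y * (i \<bullet> b)" "t y * (i \<bullet> b) \<le> i \<bullet> b"
            using y i b by (auto simp: W_def inner_Basis)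
          ultimately show ?thesis by (simp add: inner_diff_left abs_le_iff)
        qed
        then show ?thesis using j by (auto simp: Q_def mem_box inner_simps)
      qed
      then show "y \<in> (\<Union>j. Q j)" by blast
    qed
    then have "emeasure lborel W \<le> emeasure lborel (\<Union>j. Q j)"
      by (rule emeasure_mono) (auto simp: Q_def)
    also have "\<dots> \<le> (\<Sum>j. emeasure lborel (Q j))"
      by (rule emeasure_subadditive_countably) (auto simp: Q_def)
    finally have "ennreal K * emeasure lborel W \<le> ennreal K * (\<Sum>j. emeasure lborel (Q j))"
      by (rule mult_left_mono) auto
    also have "\<dots> = (\<Sum>j. ennreal K * emeasure lborel (Q j))" by simp
    also have "\<dots> \<le> (\<Sum>j. ennreal (hausdorff_gauge s (C j)))"
      by (intro suminf_le Q summableI)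
    finally show "ennreal K * emeasure lborel W \<le> (\<Sum>j. ennreal (hausdorff_gauge s (C j)))" .
  qed
  also have "\<dots> \<le> hausdorff_outer s ?A"
    unfolding hausdorff_outer_def by (rule SUP_upper) auto
  finally have "ennreal K * emeasure lborel W \<le> hausdorff_outer s ?A" .
  moreover have "0 < ennreal K * emeasure lborel W"
    using K W by (simp add: ennreal_zero_less_mult_iff)
  ultimately show ?thesis unfolding s_def by (rule order_less_le_trans[rotated])
qed

text \<open>An open set that meets a convex \<open>F\<close> meets its relative interior. The affine
  hull of \<open>F\<close> is a hyperplane, and a small ball in it fits into
  \<open>V \<inter> F\<close>.\<close>

lemma hausdorff_outer_open_Int_convex_pos:
  fixes F V :: "'a::euclidean_space set"
  assumes F: "convex F" "aff_dim F = DIM('a) - 1" and V: "open V" "V \<inter> F \<noteq> {}"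
  shows "0 < hausdorff_outer (DIM('a) - 1) (V \<inter> F)"
proof -
  obtain a b where a: "a \<noteq> 0" and hull: "affine hull F = {x. a \<bullet> x = b}"
    using F(2) aff_dim_eq_hyperplane[of F] by (auto simp: of_nat_diff)
  have "V \<inter> closure (rel_interior F) \<noteq> {}"
    using V(2) convex_closure_rel_interior[OF F(1)] closure_subset[of F] by auto
  then have "V \<inter> rel_interior F \<noteq> {}" using open_Int_closure_eq_empty[OF V(1)] by blast
  then obtain x where x: "x \<in> V" "x \<in> rel_interior F" by blast
  obtain e1 where e1: "0 < e1" "ball x e1 \<inter> affine hull F \<subseteq> F"
    using x(2) by (auto simp: mem_rel_interior_ball)
  obtain e2 where e2: "0 < e2" "ball x e2 \<subseteq> V" using V(1) x(1) by (auto simp: open_contains_ball)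
  have "a \<bullet> x = b" using x(2) rel_interior_subset hull_subset[of F affine] hull by blast
  then have "0 < hausdorff_outer (DIM('a) - 1) (ball x (min e1 e2) \<inter> {x. a \<bullet> x = b})"
    using a e1 e2 by (intro hausdorff_outer_hyperplane_ball_pos) auto
  also have "\<dots> \<le> hausdorff_outer (DIM('a) - 1) (V \<inter> F)"
    using e1(2) e2(2) hull by (intro hausdorff_outer_mono) auto
  finally show ?thesis .
qed

subsection \<open>Nodal interpolation on a surface mesh\<close>

text \<open>Translating one point \<open>c\<close> to the origin makes the others linearly
  independent, so a linear functional with prescribed values on them exists; the constant then
  corrects the value at \<open>c\<close>.\<close>

lemma affine_independent_interpolation:
  fixes C :: "'a::euclidean_space set"
  assumes "\<not> affine_dependent C"
  obtains a b where "\<And>x. x \<in> C \<Longrightarrow> a \<bullet> x + b = f x"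
proof (cases "C = {}")
  case False
  then obtain c where c: "c \<in> C" by blast
  let ?g = "\<lambda>y. f (c + y) - f c"
  have "independent ((\<lambda>x. - c + x) ` (C - {c}))"
    using assms affine_dependent_iff_dependent2[OF c] by blast
  then obtain g where g: "linear g" "\<And>y. y \<in> (\<lambda>x. - c + x) ` (C - {c}) \<Longrightarrow> g y = ?g y"
    using linear_independent_extend[of _ ?g] by blast
  \<comment> \<open>The Riesz representative of the functional \<open>g\<close>.\<close>
  define a where "a = adjoint g 1"
  have a: "a \<bullet> x = g x" for x
    using adjoint_works[OF g(1), of x 1] by (simp add: a_def inner_commute)
  have "a \<bullet> x + (f c - a \<bullet> c) = f x" if "x \<in> C" for x
  proof (cases "x = c")
    case False
    then have "g (- c + x) = f x - f c" using g(2)[of "- c + x"] that by auto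
    then show ?thesis by (simp add: a[symmetric] inner_simps)
  qed simp
  then show ?thesis by (rule that)
qed (use that in auto)

text \<open>The inequality between two affine functions holds on a convex set, and \<open>K\<close>
  is the convex hull of its extreme points.\<close>

lemma affine_le_from_extreme_points:
  fixes K :: "'a::euclidean_space set"
  assumes K: "compact K" "convex K" and x: "x \<in> K"
    and le: "\<And>z. z extreme_point_of K \<Longrightarrow> a \<bullet> z + b \<le> a' \<bullet> z + b'"
  shows "a \<bullet> x + b \<le> a' \<bullet> x + b'"
proof -
  have eq: "{z. a \<bullet> z + b \<le> a' \<bullet> z + b'} = {z. (a - a') \<bullet> z \<le> b' - b}"
    by (auto simp: inner_simps)
  have "convex {z. a \<bullet> z + b \<le> a' \<bullet> z + b'}"
    unfolding eq by (rule convex_halfspace_le)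
  then have "convex hull {z. z extreme_point_of K} \<subseteq> {z. a \<bullet> z + b \<le> a' \<bullet> z + b'}"
    using le by (intro hull_minimal) auto
  then show ?thesis using x Krein_Milman_Minkowski[OF K] by auto
qed

section \<open>Facets and nodes of the surface mesh\<close>

locale surface_mesh =
  fixes \<Omega> \<Gamma> :: "'a::euclidean_space set" and \<T> :: "'a set set"
  assumes triangulation: "triangulation_of \<Omega> \<T>"
    and facets_cover: "closure \<Gamma> = \<Union>(facets_on \<Omega> \<T> \<Gamma>)"
    and openin_frontier: "openin (top_of_set (frontier \<Omega>)) \<Gamma>"
begin

abbreviation "facets \<equiv> facets_on \<Omega> \<T> \<Gamma>"
abbreviation "nodes \<equiv> mesh_nodes \<T> \<inter> closure \<Gamma>"
abbreviation "FE \<equiv> S1 \<Omega> \<T> \<Gamma>"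
abbreviation "interp \<equiv> nodal_interp \<Omega> \<T> \<Gamma>"

text \<open>A facet of a simplex is spanned by all its vertices but one, which leaves
  \<open>DIM('a)\<close> affinely independent points.\<close>

lemma facetE:
  assumes "F \<in> facets"
  obtains T C where "T \<in> \<T>" "F face_of T" "finite C" "\<not> affine_dependent C" "card C = DIM('a)"
    "F = convex hull C"
proof -
  obtain T where T: "T \<in> \<T>" "F facet_of T"
    using assms by (auto simp: facets_on_def boundary_facets_def)
  then have "int DIM('a) simplex T" using triangulation by (auto simp: triangulation_of_def)
  then obtain C where C: "finite C" "\<not> affine_dependent C" "int (card C) = int DIM('a) + 1" "T = convex hull C"
    by (auto simp: simplex)
  then obtain u where u: "u \<in> C" "F = convex hull (C - {u})"
    using T(2) facet_of_convex_hull_affine_independent[OF C(2)] by auto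
  have "\<not> affine_dependent (C - {u})" using C(2) affine_dependent_subset by blast
  moreover have "card (C - {u}) = DIM('a)" using C(1,3) u(1) by simp
  ultimately show ?thesis
    using that[of T "C - {u}"] T C(1) u(2) facet_of_imp_face_of by blast
qed

lemma facet_convex: "F \<in> facets \<Longrightarrow> convex F"
  by (erule facetE) auto

lemma facet_compact: "F \<in> facets \<Longrightarrow> compact F"
  by (erule facetE) (auto simp: compact_convex_hull finite_imp_compact)

lemma facet_subset: "F \<in> facets \<Longrightarrow> F \<subseteq> closure \<Gamma>"
  by (simp add: facets_on_def)

lemma finite_triangulation: "finite \<T>"
  using triangulation by (simp add: triangulation_of_def triangulation_def)

lemma finite_facets: "finite facets"
proof (rule finite_subset)
  show "facets \<subseteq> (\<Union>T\<in>\<T>. {F. F face_of T})"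
    by (auto elim!: facetE)
  show "finite (\<Union>T\<in>\<T>. {F. F face_of T})"
    using triangulation finite_triangulation
    by (auto simp: triangulation_of_def intro!: finite_polytope_faces dest: simplex_imp_polytope)
qed

lemma compact_closure_surface: "compact (closure \<Gamma>)"
  unfolding facets_cover using finite_facets facet_compact by (rule compact_Union)

lemma triangulation_Int:
  assumes "T \<in> \<T>" "T' \<in> \<T>"
  shows "T \<inter> T' face_of T" "T \<inter> T' face_of T'"
  using triangulation assms unfolding triangulation_of_def triangulation_def
  by (blast, metis Int_commute)

text \<open>Conformity passes from the elements to their faces: where \<open>T \<inter> T'\<close>
  is a face of both, a face of \<open>T\<close> and a face of \<open>T'\<close> also meet in a
  common face.\<close>

lemma facet_Int:
  assumes "F \<in> facets" "G \<in> facets"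
  shows "F \<inter> G face_of F" "F \<inter> G face_of G"
proof -
  obtain T where T: "T \<in> \<T>" "F face_of T" using assms(1) by (rule facetE)
  obtain T' where T': "T' \<in> \<T>" "G face_of T'" using assms(2) by (rule facetE)
  show "F \<inter> G face_of F" "F \<inter> G face_of G"
    using face_of_Int_subface[OF triangulation_Int[OF T(1) T'(1)] T(2) T'(2)] by auto
qed

text \<open>There are no hanging nodes: a node in \<open>F\<close> may come as a vertex of another
  element \<open>T'\<close>, but the common face \<open>T \<inter> T'\<close> makes it a vertex of
  \<open>T\<close>, hence of \<open>F\<close>.\<close>

lemma extreme_point_of_facet_iff:
  assumes F: "F \<in> facets"
  shows "z extreme_point_of F \<longleftrightarrow> z \<in> nodes \<inter> F"
proof
  obtain T where T: "T \<in> \<T>" "F face_of T" using F by (rule facetE)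
  {
    assume "z extreme_point_of F"
    then show "z \<in> nodes \<inter> F"
      using T F extreme_point_of_face[OF T(2)] by (auto simp: mesh_nodes_def facets_on_def)
  }
  assume z: "z \<in> nodes \<inter> F"
  then obtain T' where T': "T' \<in> \<T>" "z extreme_point_of T'" by (auto simp: mesh_nodes_def)
  have "z \<in> T \<inter> T'"
    using z T(2) T'(2) face_of_imp_subset by (auto simp: extreme_point_of_def)
  then have "z extreme_point_of T"
    using T'(2) extreme_point_of_face[OF triangulation_Int(1)[OF T(1) T'(1)]]
      extreme_point_of_face[OF triangulation_Int(2)[OF T(1) T'(1)]] by blast
  then show "z extreme_point_of F" using z extreme_point_of_face[OF T(2)] by blast
qed

lemma finite_nodes: "finite nodes"
proof (rule finite_subset)
  show "nodes \<subseteq> (\<Union>F\<in>facets. {z. z extreme_point_of F})"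
    using facets_cover extreme_point_of_facet_iff by auto
  have "finite {z. z extreme_point_of F}" if F: "F \<in> facets" for F
    using that
  proof (rule facetE)
    fix T C assume C: "finite C" "F = convex hull C"
    then have "{z. z extreme_point_of F} \<subseteq> C" using extreme_point_of_convex_hull by auto
    then show ?thesis using C(1) finite_subset by blast
  qed
  then show "finite (\<Union>F\<in>facets. {z. z extreme_point_of F})" using finite_facets by blast
qed

section \<open>The finite element space and nodal interpolation\<close>

lemma FE_continuous: "w \<in> FE \<Longrightarrow> continuous_on (closure \<Gamma>) w"
  by (simp add: S1_def)

text \<open>Comparison principle: on each facet both functions are affine and the extreme points are
  nodes. Uniqueness of interpolation and all nonnegativity statements rest on it.\<close>

lemma FE_le:
  assumes w: "w \<in> FE" "w' \<in> FE" and le: "\<And>z. z \<in> nodes \<Longrightarrow> w z \<le> w' z" and x: "x \<in> closure \<Gamma>"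
  shows "w x \<le> w' x"
proof -
  obtain F where F: "F \<in> facets" "x \<in> F" using x facets_cover by auto
  obtain a b where a: "\<And>x. x \<in> F \<Longrightarrow> w x = a \<bullet> x + b" using w(1) F(1) by (auto simp: S1_def)
  obtain a' b' where a': "\<And>x. x \<in> F \<Longrightarrow> w' x = a' \<bullet> x + b'" using w(2) F(1) by (auto simp: S1_def)
  have "a \<bullet> x + b \<le> a' \<bullet> x + b'"
    using facet_compact[OF F(1)] facet_convex[OF F(1)] F(2)
  proof (rule affine_le_from_extreme_points)
    fix z assume "z extreme_point_of F"
    then have "z \<in> nodes" "z \<in> F" using extreme_point_of_facet_iff[OF F(1)] by auto
    then show "a \<bullet> z + b \<le> a' \<bullet> z + b'" using le a a' by metis
  qed
  then show ?thesis using a a' F(2) by simp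
qed

lemma FE_eqI:
  assumes w: "w \<in> FE" "w' \<in> FE" and eq: "\<And>z. z \<in> nodes \<Longrightarrow> w z = w' z"
  shows "w = w'"
proof (rule extensionalityI)
  show "w \<in> extensional (closure \<Gamma>)" "w' \<in> extensional (closure \<Gamma>)"
    using w by (auto simp: S1_def)
  fix x assume "x \<in> closure \<Gamma>"
  then show "w x = w' x" using FE_le[OF w] FE_le[OF w(2,1)] eq by (intro antisym) auto
qed

text \<open>Each facet carries an affine function with the given values at its vertices. Two of them
  agree on \<open>F \<inter> G\<close>, whose extreme points are vertices of both facets, so they
  paste to a continuous function on a finite closed cover.\<close>

lemma FE_interpolant_exists: "\<exists>w\<in>FE. \<forall>z\<in>nodes. w z = v z"
proof -
  have "\<exists>a b. \<forall>z. z extreme_point_of F \<longrightarrow> a \<bullet> z + b = v z" if "F \<in> facets" for F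
    using that
  proof (rule facetE)
    fix T C assume C: "\<not> affine_dependent C" "F = convex hull C"
    obtain a b where "\<And>x. x \<in> C \<Longrightarrow> a \<bullet> x + b = v x"
      using affine_independent_interpolation[OF C(1)] by blast
    then show ?thesis using extreme_point_of_convex_hull C(2) by blast
  qed
  then obtain a b where ab: "\<And>F z. F \<in> facets \<Longrightarrow> z extreme_point_of F \<Longrightarrow> a F \<bullet> z + b F = v z"
    by metis
  \<comment> \<open>One inequality is enough: exchanging \<open>F\<close> and \<open>G\<close> gives
    the other.\<close>
  have agree: "a F \<bullet> x + b F \<le> a G \<bullet> x + b G" if FG: "F \<in> facets" "G \<in> facets" "x \<in> F \<inter> G" for F G x
  proof (rule affine_le_from_extreme_points[OF _ _ FG(3)])
    show "compact (F \<inter> G)" using FG by (intro compact_Int facet_compact)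
    show "convex (F \<inter> G)" using FG by (intro convex_Int facet_convex)
    fix z assume "z extreme_point_of (F \<inter> G)"
    then have "z extreme_point_of F" "z extreme_point_of G"
      using extreme_point_of_face[OF facet_Int(1)[OF FG(1,2)]]
        extreme_point_of_face[OF facet_Int(2)[OF FG(1,2)]] by auto
    then show "a F \<bullet> z + b F \<le> a G \<bullet> z + b G" using ab FG by simp
  qed
  obtain g where g: "continuous_map (top_of_set (closure \<Gamma>)) euclidean g"
    "\<And>x F. F \<in> facets \<Longrightarrow> x \<in> topspace (top_of_set (closure \<Gamma>)) \<inter> F \<Longrightarrow> g x = a F \<bullet> x + b F"
  proof (rule pasting_lemma_exists_closed[of facets "top_of_set (closure \<Gamma>)" "\<lambda>F. F" euclidean
        "\<lambda>F x. a F \<bullet> x + b F"])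
    show "finite facets" by (rule finite_facets)
    show "topspace (top_of_set (closure \<Gamma>)) \<subseteq> \<Union>((\<lambda>F. F) ` facets)" using facets_cover by auto
    fix F assume F: "F \<in> facets"
    show "closedin (top_of_set (closure \<Gamma>)) F"
      using facet_compact[OF F] facet_subset[OF F] by (simp add: closed_subset compact_imp_closed)
    show "continuous_map (subtopology (top_of_set (closure \<Gamma>)) F) euclidean (\<lambda>x. a F \<bullet> x + b F)"
      unfolding subtopology_subtopology by (auto intro!: continuous_intros)
  next
    fix F G x assume "F \<in> facets" "G \<in> facets" "x \<in> topspace (top_of_set (closure \<Gamma>)) \<inter> F \<inter> G"
    then show "a F \<bullet> x + b F = a G \<bullet> x + b G" using agree[of F G x] agree[of G F x] by auto
  qed blast
  have gF: "g x = a F \<bullet> x + b F" if "F \<in> facets" "x \<in> F" for F x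
    using g(2)[OF that(1)] that facet_subset by auto
  define w where "w = restrict g (closure \<Gamma>)"
  have "continuous_on (closure \<Gamma>) w"
    using g(1) by (auto simp: w_def cong: continuous_on_cong)
  moreover have "\<exists>a b. \<forall>x\<in>F. w x = a \<bullet> x + b" if F: "F \<in> facets" for F
    using gF[OF F] facet_subset[OF F] by (auto simp: w_def subset_iff)
  ultimately have "w \<in> FE" by (auto simp: S1_def w_def)
  moreover have "w z = v z" if z: "z \<in> nodes" for z
  proof -
    obtain F where F: "F \<in> facets" "z \<in> F" using z facets_cover by auto
    then have "z extreme_point_of F" using z extreme_point_of_facet_iff by blast
    then show ?thesis using ab[OF F(1)] gF[OF F] z by (simp add: w_def)
  qed
  ultimately show ?thesis by blast
qed

text \<open>Existence and uniqueness of the interpolant justify the \<open>THE\<close> in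
  \<open>nodal_interp\<close>, for an arbitrary function \<open>v\<close>.\<close>

lemma
  shows interp_FE: "interp v \<in> FE"
    and interp_node: "z \<in> nodes \<Longrightarrow> interp v z = v z"
proof -
  have "\<exists>!w. w \<in> FE \<and> (\<forall>z\<in>nodes. w z = v z)"
    using FE_interpolant_exists[of v] FE_eqI by (metis (no_types, lifting))
  from theI'[OF this] show "interp v \<in> FE" "z \<in> nodes \<Longrightarrow> interp v z = v z"
    unfolding nodal_interp_def by auto
qed

lemma interp_FE_eq: "w \<in> FE \<Longrightarrow> interp w = w"
  by (rule FE_eqI) (auto simp: interp_FE interp_node)

section \<open>Linear combinations and the nodal basis\<close>

lemma FE_sum:
  assumes w: "\<And>i. i \<in> I \<Longrightarrow> w i \<in> FE"
  shows "restrict (\<lambda>x. \<Sum>i\<in>I. c i * w i x) (closure \<Gamma>) \<in> FE"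
proof -
  have "\<exists>a b. \<forall>x\<in>F. restrict (\<lambda>x. \<Sum>i\<in>I. c i * w i x) (closure \<Gamma>) x = a \<bullet> x + b"
    if F: "F \<in> facets" for F
  proof -
    have "\<exists>a b. \<forall>x\<in>F. w i x = a \<bullet> x + b" if "i \<in> I" for i
      using w[OF that] F by (auto simp: S1_def)
    then obtain a b where "\<And>i x. i \<in> I \<Longrightarrow> x \<in> F \<Longrightarrow> w i x = a i \<bullet> x + b i" by metis
    then have "restrict (\<lambda>x. \<Sum>i\<in>I. c i * w i x) (closure \<Gamma>) x
        = (\<Sum>i\<in>I. c i *\<^sub>R a i) \<bullet> x + (\<Sum>i\<in>I. c i * b i)" if "x \<in> F" for x
      using that facet_subset[OF F]
      by (auto simp: subset_iff inner_sum_left algebra_simps sum.distrib[symmetric] intro!: sum.cong)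
    then show ?thesis by blast
  qed
  moreover have "continuous_on (closure \<Gamma>) (\<lambda>x. \<Sum>i\<in>I. c i * w i x)"
    by (intro continuous_on_sum continuous_on_mult continuous_on_const FE_continuous w)
  ultimately show ?thesis by (auto simp: S1_def cong: continuous_on_cong)
qed

text \<open>The interpolated indicator of \<open>z\<close> is discontinuous in general, which is
  harmless because interpolation reads nodal values only.\<close>

definition hat :: "'a \<Rightarrow> 'a \<Rightarrow> real" where
  "hat z = interp (\<lambda>x. if x = z then 1 else 0)"

lemma hat_FE: "hat z \<in> FE"
  by (simp add: hat_def interp_FE)

lemma hat_node: "y \<in> nodes \<Longrightarrow> hat z y = (if y = z then 1 else 0)"
  unfolding hat_def by (rule interp_node)

lemma zero_FE: "restrict (\<lambda>_. 0) (closure \<Gamma>) \<in> FE"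
  using FE_sum[of "{}"] by simp

text \<open>The nodal expansion of this function is the partition of unity behind the conservation
  of mass.\<close>

lemma one_FE: "restrict (\<lambda>_. 1) (closure \<Gamma>) \<in> FE"
proof -
  have "\<exists>a b. \<forall>x\<in>F. restrict (\<lambda>_. 1) (closure \<Gamma>) x = a \<bullet> x + b" if "F \<in> facets" for F
    using facet_subset[OF that] by (intro exI[of _ 0] exI[of _ 1]) auto
  then show ?thesis by (auto simp: S1_def cong: continuous_on_cong)
qed

lemma hat_nonneg: "x \<in> closure \<Gamma> \<Longrightarrow> 0 \<le> hat z x"
  using FE_le[OF zero_FE hat_FE, of z x] by (auto simp: hat_node)

lemma sum_hat_node: "y \<in> nodes \<Longrightarrow> (\<Sum>z\<in>nodes. c z * hat z y) = c y"
  using finite_nodes by (simp add: hat_node sum.delta if_distrib cong: if_cong sum.cong)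

text \<open>Both sides belong to the finite element space and have the same nodal values.\<close>

lemma interp_expand:
  assumes "x \<in> closure \<Gamma>"
  shows "interp v x = (\<Sum>z\<in>nodes. v z * hat z x)"
proof -
  have "interp v = restrict (\<lambda>x. \<Sum>z\<in>nodes. v z * hat z x) (closure \<Gamma>)"
    by (rule FE_eqI) (auto simp: interp_FE interp_node sum_hat_node intro!: FE_sum hat_FE)
  then show ?thesis using assms by simp
qed

lemma FE_expand: "w \<in> FE \<Longrightarrow> x \<in> closure \<Gamma> \<Longrightarrow> w x = (\<Sum>z\<in>nodes. w z * hat z x)"
  using interp_expand[of x w] interp_FE_eq by simp

subsection \<open>Integration over the surface and the lumped projection\<close>

abbreviation "\<sigma> \<equiv> surface \<Gamma>"

lemma surface_eq_Int_open:
  obtains V where "open V" "\<Gamma> = frontier \<Omega> \<inter> V"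
  using openin_frontier by (auto simp: openin_open)

lemma surface_in_sets: "\<Gamma> \<in> sets (hausdorff_measure s)"
proof -
  obtain V where "open V" "\<Gamma> = frontier \<Omega> \<inter> V" by (rule surface_eq_Int_open)
  then have "\<Gamma> \<in> sets borel" by simp
  then show ?thesis using sets_borel_subset_hausdorff_measure by blast
qed

lemma space_surface: "space \<sigma> = \<Gamma>"
  by (simp add: surface_def space_restrict_space)

lemma emeasure_surface:
  "A \<subseteq> \<Gamma> \<Longrightarrow> emeasure \<sigma> A = emeasure (hausdorff_measure (DIM('a) - 1)) A"
  unfolding surface_def by (rule emeasure_restrict_space) (auto simp: surface_in_sets)

text \<open>\<open>\<Gamma>\<close> is covered by finitely many facets, each the hull of
  \<open>DIM('a)\<close> points and so of finite measure in dimension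
  \<open>DIM('a) - 1\<close>.\<close>

lemma finite_measure_surface: "finite_measure \<sigma>"
proof (rule finite_measureI)
  let ?H = "hausdorff_measure (DIM('a) - 1) :: 'a measure"
  have FH: "F \<in> sets ?H" if "F \<in> facets" for F
    using compact_imp_closed[OF facet_compact[OF that]] sets_borel_subset_hausdorff_measure
    by (metis borel_closed subsetD)
  have fin: "emeasure ?H F < top" if F: "F \<in> facets" for F
    using F
  proof (rule facetE)
    fix T C assume C: "finite C" "card C = DIM('a)" "F = convex hull C"
    then obtain c where "c \<in> C" using DIM_positive by (metis card.empty ex_in_conv less_irrefl)
    then show ?thesis
      using hausdorff_outer_convex_hull_finite[OF C(1)] C(2,3) emeasure_hausdorff_measure[OF FH[OF F]]
      by simp
  qed
  have "emeasure \<sigma> \<Gamma> = emeasure ?H \<Gamma>" by (rule emeasure_surface) simp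
  also have "\<dots> \<le> emeasure ?H (\<Union>F\<in>facets. F)"
    using closure_subset[of \<Gamma>] facets_cover FH finite_facets by (intro emeasure_mono) auto
  also have "\<dots> \<le> (\<Sum>F\<in>facets. emeasure ?H F)"
    using finite_facets FH by (intro emeasure_subadditive_finite) auto
  also have "\<dots> < top" using fin finite_facets by simp
  finally show "emeasure \<sigma> (space \<sigma>) \<noteq> \<infinity>" by (simp add: space_surface)
qed

lemma integrable_const_surface: "integrable \<sigma> (\<lambda>_. c :: real)"
  using finite_measure_surface by (rule finite_measure.integrable_const)

text \<open>The measurable sets of \<open>\<sigma>\<close> include the traces of all Borel sets on
  \<open>\<Gamma>\<close>.\<close>

lemma continuous_borel_measurable:
  fixes f :: "'a \<Rightarrow> real"
  assumes "continuous_on \<Gamma> f"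
  shows "f \<in> borel_measurable \<sigma>"
proof -
  have "sets (restrict_space borel \<Gamma>) \<subseteq> sets \<sigma>"
    using sets_borel_subset_hausdorff_measure unfolding surface_def sets_restrict_space by blast
  then show ?thesis
    using borel_measurable_continuous_on_restrict[OF assms]
    by (auto simp: measurable_def space_surface space_restrict_space)
qed

text \<open>An open set meeting the closure meets \<open>\<Gamma>\<close> itself, in a point of some
  facet \<open>F\<close>. As \<open>F\<close> lies in the frontier, from which an open
  \<open>V\<close> cuts out \<open>\<Gamma>\<close>, the relatively open piece
  \<open>(U \<inter> V) \<inter> F\<close> of \<open>F\<close> is part of
  \<open>U \<inter> \<Gamma>\<close>.\<close>

lemma emeasure_surface_open_pos:
  assumes U: "open U" "U \<inter> closure \<Gamma> \<noteq> {}"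
  shows "U \<inter> \<Gamma> \<in> sets \<sigma>" "0 < emeasure \<sigma> (U \<inter> \<Gamma>)"
proof -
  obtain V where V: "open V" "\<Gamma> = frontier \<Omega> \<inter> V" by (rule surface_eq_Int_open)
  have UH: "U \<inter> \<Gamma> \<in> sets (hausdorff_measure s)" for s
    using sets_borel_subset_hausdorff_measure borel_open[OF U(1)] surface_in_sets by blast
  then show "U \<inter> \<Gamma> \<in> sets \<sigma>"
    unfolding surface_def sets_restrict_space by (metis image_eqI inf_commute inf_left_idem)
  obtain x where x: "x \<in> U" "x \<in> \<Gamma>" using U open_Int_closure_eq_empty by blast
  then obtain F where F: "F \<in> facets" "x \<in> F" using closure_subset facets_cover by blast
  obtain C where C: "\<not> affine_dependent C" "card C = DIM('a)" "F = convex hull C"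
    using F(1) by (rule facetE)
  have "aff_dim F = int DIM('a) - 1"
    using C by (simp add: aff_dim_convex_hull affine_independent_iff_card)
  then have "0 < hausdorff_outer (DIM('a) - 1) ((U \<inter> V) \<inter> F)"
    using x F V U facet_convex[OF F(1)]
    by (intro hausdorff_outer_open_Int_convex_pos) auto
  also have "\<dots> \<le> hausdorff_outer (DIM('a) - 1) (U \<inter> \<Gamma>)"
    using F(1) V by (intro hausdorff_outer_mono) (auto simp: facets_on_def boundary_facets_def)
  finally show "0 < emeasure \<sigma> (U \<inter> \<Gamma>)"
    by (simp add: emeasure_surface emeasure_hausdorff_measure[OF UH])
qed

section \<open>Nodal expansion of integrals and positivity of the weights\<close>

lemma integrable_mult_FE:
  assumes \<eta>: "integrable \<sigma> \<eta>" and w: "w \<in> FE"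
  shows "integrable \<sigma> (\<lambda>x. \<eta> x * w x)"
proof -
  have "bounded (w ` closure \<Gamma>)"
    using compact_closure_surface FE_continuous[OF w]
    by (intro compact_imp_bounded compact_continuous_image)
  then obtain B where B: "\<And>x. x \<in> closure \<Gamma> \<Longrightarrow> \<bar>w x\<bar> \<le> B" by (auto simp: bounded_iff)
  have [measurable]: "w \<in> borel_measurable \<sigma>"
    using FE_continuous[OF w] closure_subset
    by (intro continuous_borel_measurable) (rule continuous_on_subset)
  have [measurable]: "\<eta> \<in> borel_measurable \<sigma>" using \<eta> by (rule borel_measurable_integrable)
  show ?thesis
  proof (rule Bochner_Integration.integrable_bound)
    show "integrable \<sigma> (\<lambda>x. B * \<eta> x)" using \<eta> by simp
    show "AE x in \<sigma>. norm (\<eta> x * w x) \<le> norm (B * \<eta> x)"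
    proof (rule AE_I2)
      fix x assume "x \<in> space \<sigma>"
      then have "\<bar>w x\<bar> \<le> \<bar>B\<bar>" using B[of x] closure_subset[of \<Gamma>] by (auto simp: space_surface)
      then show "norm (\<eta> x * w x) \<le> norm (B * \<eta> x)"
        using mult_right_mono[of "\<bar>w x\<bar>" "\<bar>B\<bar>" "\<bar>\<eta> x\<bar>"] by (simp add: abs_mult mult.commute)
    qed
  qed measurable
qed

lemma integrable_FE: "w \<in> FE \<Longrightarrow> integrable \<sigma> w"
  using integrable_mult_FE[OF integrable_const_surface[of 1]] by simp

lemma ip_FE_expand:
  assumes \<eta>: "integrable \<sigma> \<eta>" and w: "w \<in> FE"
  shows "ip \<Gamma> \<eta> w = (\<Sum>z\<in>nodes. w z * ip \<Gamma> \<eta> (hat z))"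
proof -
  have "ip \<Gamma> \<eta> w = (LINT x|\<sigma>. (\<Sum>z\<in>nodes. w z * (\<eta> x * hat z x)))"
    unfolding ip_def
  proof (rule Bochner_Integration.integral_cong)
    fix x assume "x \<in> space \<sigma>"
    then have "x \<in> closure \<Gamma>" using closure_subset by (auto simp: space_surface)
    then show "\<eta> x * w x = (\<Sum>z\<in>nodes. w z * (\<eta> x * hat z x))"
      by (subst FE_expand[OF w]) (auto simp: sum_distrib_left mult_ac)
  qed simp
  also have "\<dots> = (\<Sum>z\<in>nodes. w z * ip \<Gamma> \<eta> (hat z))"
    unfolding ip_def using integrable_mult_FE[OF \<eta> hat_FE]
    by (subst Bochner_Integration.integral_sum) auto
  finally show ?thesis .
qed

abbreviation weight :: "'a \<Rightarrow> real" where
  "weight z \<equiv> LINT x|\<sigma>. hat z x"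

text \<open>The hat function is 1 at \<open>z\<close>, hence positive on a neighbourhood of
  \<open>z\<close> in the closure. Even if \<open>z\<close> lies outside \<open>\<Gamma>\<close>,
  this neighbourhood meets \<open>\<Gamma>\<close> in positive measure, so the integral cannot
  vanish.\<close>

lemma weight_pos:
  assumes z: "z \<in> nodes"
  shows "0 < weight z"
proof -
  have nonneg: "AE x in \<sigma>. 0 \<le> hat z x"
    using closure_subset by (intro AE_I2 hat_nonneg) (auto simp: space_surface)
  have "weight z \<noteq> 0"
  proof
    assume "weight z = 0"
    then have zero: "AE x in \<sigma>. hat z x = 0"
      using integral_nonneg_eq_0_iff_AE[OF integrable_FE[OF hat_FE] nonneg] by simp
    have "openin (top_of_set (closure \<Gamma>)) (closure \<Gamma> \<inter> hat z -` {0<..})"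
      using FE_continuous[OF hat_FE] by (rule continuous_openin_preimage_gen) auto
    then obtain U where U: "open U" "closure \<Gamma> \<inter> hat z -` {0<..} = closure \<Gamma> \<inter> U"
      by (auto simp: openin_open)
    have "z \<in> U \<inter> closure \<Gamma>" using U(2) z hat_node[OF z] by auto
    then have pos: "U \<inter> \<Gamma> \<in> sets \<sigma>" "0 < emeasure \<sigma> (U \<inter> \<Gamma>)"
      using emeasure_surface_open_pos[OF U(1)] by auto
    have "AE x in \<sigma>. x \<notin> U \<inter> \<Gamma>"
      using zero
    proof eventually_elim
      case (elim x)
      have "0 < hat z x" if "x \<in> U \<inter> \<Gamma>"
      proof -
        have "x \<in> closure \<Gamma> \<inter> U" using that closure_subset[of \<Gamma>] by blast
        then show ?thesis unfolding U(2)[symmetric] by simp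
      qed
      then show ?case using elim by auto
    qed
    then have "U \<inter> \<Gamma> \<in> null_sets \<sigma>" using AE_iff_null_sets[OF pos(1)] by simp
    then show False using pos(2) by (simp add: null_setsD1)
  qed
  moreover have "0 \<le> weight z" using nonneg by (rule integral_nonneg_AE)
  ultimately show ?thesis by simp
qed

lemma integral_FE:
  assumes "w \<in> FE"
  shows "(LINT x|\<sigma>. w x) = (\<Sum>z\<in>nodes. w z * weight z)"
  using ip_FE_expand[OF integrable_const_surface[of 1] assms]
  by (simp add: ip_def)

text \<open>Interpolating the product leaves only its nodal values, so the lumped product is
  diagonal in the nodal basis.\<close>

lemma lumped_ip_eq: "lumped_ip \<Omega> \<T> \<Gamma> v w = (\<Sum>z\<in>nodes. v z * w z * weight z)"
  using integral_FE[OF interp_FE, of "\<lambda>x. v x * w x"]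
  by (simp add: lumped_ip_def ip_def interp_node)

section \<open>The lumped projection of an integrable function\<close>

context
  fixes \<eta> :: "'a \<Rightarrow> real"
  assumes \<eta>: "integrable \<sigma> \<eta>"
begin

abbreviation "P\<eta> \<equiv> lumped_projection \<Omega> \<T> \<Gamma> \<eta>"

text \<open>Testing with \<open>hat z\<close> isolates \<open>p z * weight z\<close> and fixes every
  nodal value; conversely, these values satisfy the equation for all test functions by nodal
  expansion. The equivalence \<open>iff\<close> thus gives uniqueness and existence for the
  \<open>THE\<close> at once.\<close>

lemma
  shows lumped_projection_FE: "P\<eta> \<in> FE"
    and lumped_projection_node: "z \<in> nodes \<Longrightarrow> P\<eta> z = ip \<Gamma> \<eta> (hat z) / weight z"
proof -
  let ?v = "\<lambda>z. ip \<Gamma> \<eta> (hat z) / weight z"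
  have iff: "p \<in> FE \<and> (\<forall>\<mu>\<in>FE. lumped_ip \<Omega> \<T> \<Gamma> p \<mu> = ip \<Gamma> \<eta> \<mu>) \<longleftrightarrow> p = interp ?v" for p
  proof safe
    assume p: "p \<in> FE" "\<forall>\<mu>\<in>FE. lumped_ip \<Omega> \<T> \<Gamma> p \<mu> = ip \<Gamma> \<eta> \<mu>"
    have "p z = ?v z" if z: "z \<in> nodes" for z
    proof -
      have "ip \<Gamma> \<eta> (hat z) = (\<Sum>y\<in>nodes. p y * hat z y * weight y)"
        using p(2) hat_FE[of z] by (simp add: lumped_ip_eq)
      also have "\<dots> = (\<Sum>y\<in>nodes. if y = z then p z * weight z else 0)"
        by (rule sum.cong) (auto simp: hat_node)
      also have "\<dots> = p z * weight z" using z finite_nodes by simp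
      finally show ?thesis using weight_pos[OF z] by simp
    qed
    then show "p = interp ?v"
      using p(1) by (intro FE_eqI) (auto simp: interp_FE interp_node)
  next
    fix \<mu> assume \<mu>: "\<mu> \<in> FE"
    have "lumped_ip \<Omega> \<T> \<Gamma> (interp ?v) \<mu> = (\<Sum>z\<in>nodes. \<mu> z * ip \<Gamma> \<eta> (hat z))"
      unfolding lumped_ip_eq
    proof (rule sum.cong)
      fix z assume "z \<in> nodes"
      then show "interp ?v z * \<mu> z * weight z = \<mu> z * ip \<Gamma> \<eta> (hat z)"
        using weight_pos[of z] by (simp add: interp_node)
    qed simp
    then show "lumped_ip \<Omega> \<T> \<Gamma> (interp ?v) \<mu> = ip \<Gamma> \<eta> \<mu>" by (simp add: ip_FE_expand[OF \<eta> \<mu>])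
  qed (rule interp_FE)
  have "P\<eta> = interp ?v" unfolding lumped_projection_def iff by simp
  then show "P\<eta> \<in> FE" "z \<in> nodes \<Longrightarrow> P\<eta> z = ?v z" by (simp_all add: interp_FE interp_node)
qed

text \<open>The weights cancel against the denominators of the nodal values. What remains is the sum
  of the \<open>ip \<Gamma> \<eta> (hat z)\<close>, that is, \<open>\<eta>\<close> tested with the
  constant one.\<close>

lemma integral_lumped_projection: "(LINT x|\<sigma>. P\<eta> x) = (LINT x|\<sigma>. \<eta> x)"
proof -
  have "(LINT x|\<sigma>. P\<eta> x) = (\<Sum>z\<in>nodes. restrict (\<lambda>_. 1) (closure \<Gamma>) z * ip \<Gamma> \<eta> (hat z))"
    unfolding integral_FE[OF lumped_projection_FE]
  proof (rule sum.cong)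
    fix z assume z: "z \<in> nodes"
    then show "P\<eta> z * weight z = restrict (\<lambda>_. 1) (closure \<Gamma>) z * ip \<Gamma> \<eta> (hat z)"
      using weight_pos[OF z] by (simp add: lumped_projection_node)
  qed simp
  also have "\<dots> = ip \<Gamma> \<eta> (restrict (\<lambda>_. 1) (closure \<Gamma>))"
    by (rule ip_FE_expand[OF \<eta> one_FE, symmetric])
  also have "\<dots> = (LINT x|\<sigma>. \<eta> x)"
    unfolding ip_def using closure_subset
    by (intro Bochner_Integration.integral_cong) (auto simp: space_surface)
  finally show ?thesis .
qed

text \<open>Each nodal value is a nonnegative number divided by a positive weight; comparison with
  the zero function extends the sign from the nodes to the closure.\<close>

lemma lumped_projection_nonneg:
  assumes pos: "AE x in \<sigma>. 0 \<le> \<eta> x" and x: "x \<in> closure \<Gamma>"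
  shows "0 \<le> P\<eta> x"
proof -
  have "0 \<le> P\<eta> z" if z: "z \<in> nodes" for z
  proof -
    have "AE x in \<sigma>. 0 \<le> hat z x"
      using closure_subset by (intro AE_I2 hat_nonneg) (auto simp: space_surface)
    with pos have "0 \<le> ip \<Gamma> \<eta> (hat z)"
      unfolding ip_def by (intro integral_nonneg_AE) auto
    then show ?thesis using weight_pos[OF z] by (simp add: lumped_projection_node[OF z])
  qed
  then show ?thesis using FE_le[OF zero_FE lumped_projection_FE _ x] x by simp
qed

end

text \<open>The surface measure is finite and \<open>\<bar>t\<bar> \<le> 1 + t\<^sup>2\<close>,
  which follows from the square of \<open>\<bar>t\<bar> - 1\<close>.\<close>

lemma integrable_L2:
  assumes "\<eta> \<in> L2_space \<Gamma>"
  shows "integrable \<sigma> \<eta>"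
proof (rule Bochner_Integration.integrable_bound)
  show "integrable \<sigma> (\<lambda>x. 1 + (\<eta> x)\<^sup>2)"
    using assms integrable_const_surface by (simp add: L2_space_def)
  show "\<eta> \<in> borel_measurable \<sigma>" using assms by (simp add: L2_space_def)
  have "\<bar>t\<bar> \<le> 1 + t\<^sup>2" for t :: real
    using zero_le_power2[of "\<bar>t\<bar> - 1"] by (simp add: power2_diff)
  then show "AE x in \<sigma>. norm (\<eta> x) \<le> norm (1 + (\<eta> x)\<^sup>2)"
    by (intro AE_I2) (auto intro: order_trans[OF _ abs_ge_self])
qed

end

theorem lemmaB1:
  fixes \<Omega> \<Gamma> :: "'a::euclidean_space set"
    and \<TT> :: "'a set set set" and \<T> :: "'a set set" and m :: real
  assumes "DIM('a) \<in> {2, 3}"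
    and "bounded_polyhedral_lipschitz_domain \<Omega>"
    and "\<Gamma> \<noteq> {}" and "openin (top_of_set (frontier \<Omega>)) \<Gamma>"
    and "shape_regular \<TT>"
    and "\<And>\<T>'. \<T>' \<in> \<TT> \<Longrightarrow> triangulation_of \<Omega> \<T>' \<and> closure \<Gamma> = \<Union>(facets_on \<Omega> \<T>' \<Gamma>)"
    and "\<T> \<in> \<TT>"
    and "m > 0"
  shows "(\<forall>\<eta> \<in> L1_space \<Gamma>. (AE x in surface \<Gamma>. 0 \<le> \<eta> x) \<longrightarrow>
            (AE x in surface \<Gamma>. 0 \<le> lumped_projection \<Omega> \<T> \<Gamma> \<eta> x) \<and>
            L1_norm \<Gamma> (lumped_projection \<Omega> \<T> \<Gamma> \<eta>) = L1_norm \<Gamma> \<eta>) \<and>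
         lumped_projection \<Omega> \<T> \<Gamma> ` mass_set \<Gamma> m \<subseteq> discrete_mass_set \<Omega> \<T> \<Gamma> m"
proof -
  interpret surface_mesh \<Omega> \<Gamma> \<T>
    using assms by unfold_locales auto
  \<comment> \<open>Proved at every point of \<open>\<Gamma>\<close>, as membership in
    \<open>discrete_mass_set\<close> demands.\<close>
  have nonneg: "0 \<le> lumped_projection \<Omega> \<T> \<Gamma> \<eta> x"
    if "integrable (surface \<Gamma>) \<eta>" "AE x in surface \<Gamma>. 0 \<le> \<eta> x" "x \<in> \<Gamma>" for \<eta> x
    using lumped_projection_nonneg[OF that(1,2)] that(3) closure_subset by blast
  have L1: "L1_norm \<Gamma> (lumped_projection \<Omega> \<T> \<Gamma> \<eta>) = L1_norm \<Gamma> \<eta>"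
    if \<eta>: "integrable (surface \<Gamma>) \<eta>" "AE x in surface \<Gamma>. 0 \<le> \<eta> x" for \<eta>
  proof -
    have "L1_norm \<Gamma> (lumped_projection \<Omega> \<T> \<Gamma> \<eta>) = (LINT x|surface \<Gamma>. lumped_projection \<Omega> \<T> \<Gamma> \<eta> x)"
      unfolding L1_norm_def using nonneg[OF \<eta>]
      by (intro Bochner_Integration.integral_cong) (auto simp: space_surface)
    also have "\<dots> = (LINT x|surface \<Gamma>. \<eta> x)" by (rule integral_lumped_projection[OF \<eta>(1)])
    also have "\<dots> = L1_norm \<Gamma> \<eta>"
      unfolding L1_norm_def using \<eta> by (intro integral_cong_AE) auto
    finally show ?thesis .
  qed
  have mass: "lumped_projection \<Omega> \<T> \<Gamma> \<eta> \<in> discrete_mass_set \<Omega> \<T> \<Gamma> m" if "\<eta> \<in> mass_set \<Gamma> m" for \<eta>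
  proof -
    have \<eta>: "integrable (surface \<Gamma>) \<eta>" "AE x in surface \<Gamma>. 0 \<le> \<eta> x" "(LINT x|surface \<Gamma>. \<eta> x) = m"
      using that integrable_L2 by (auto simp: mass_set_def ip_def)
    \<comment> \<open>Against the constant one, lumping is exact on the finite element space: both
      the lumped product and the integral are the weighted sum of nodal values.\<close>
    have "lumped_ip \<Omega> \<T> \<Gamma> (lumped_projection \<Omega> \<T> \<Gamma> \<eta>) (\<lambda>_. 1) = m"
      using integral_FE[OF lumped_projection_FE[OF \<eta>(1)]] integral_lumped_projection[OF \<eta>(1)] \<eta>(3)
      by (simp add: lumped_ip_eq)
    then show ?thesis
      using lumped_projection_FE[OF \<eta>(1)] nonneg[OF \<eta>(1,2)] by (auto simp: discrete_mass_set_def)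
  qed
  show ?thesis
    using nonneg L1 mass by (auto simp: L1_space_def space_surface intro!: AE_I2)
qed

end
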